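(* Let $\mathbf{k}$ be a field of characteristic $0$ and let $R = \mathbf{k}[X_1, \dots, X_n]$ be a polynomial ring in $n$ variables over $\mathbf{k}$, where $n\ge2$. Endow $R$ with an $\mathbb{N}$-grading such that each $X_i$ is homogeneous and $X_1$ has positive degree. Let $f$ be a homogeneous prime element of $R = \bigoplus_{i \in \mathbb{N}} R_i$ such that $f \notin R_0[X_1]$. (a) If $c \in \mathbf{k}$ then $R/(f - c)R$ is a domain with trivial units. (b) If $R/fR$ is rigid then so is $R/(f - c)R$ for every $c \in \mathbf{k}$.
   Context: $\mathbb{N}$ contains $0$; an $\mathbb{N}$-grading of $R$ is a decomposition $R=\bigoplus_{i\in\mathbb{N}}R_i$ into additive subgroups with $R_iR_j\subseteq R_{i+j}$ (automatically $\mathbf{k}\subseteq R_0$). "Domain" means integral domain. A $\mathbf{k}$-algebra $A$ has trivial units if $A^*=\mathbf{k}^*$. A derivation $D:A\to A$ of a ring is locally nilpotent if for each $b\in A$ there is $m>0$ with $D^m(b)=0$; a ring is rigid if its only locally nilpotent derivation is $0$. *)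

theory Defs
  imports
    "HOL-Algebra.Algebra"
    "HOL-Algebra.Algebraic_Closure_Type"
    "HOL-Computational_Algebra.Computational_Algebra"
    "HOL-Library.Poly_Mapping"
    "HOL-Library.Cardinality"
begin

text \<open>
  The polynomial ring over \<open>'k\<close> in variables indexed by \<open>'x\<close>: finitely supported
  functions from exponent vectors to coefficients, with the convolution product.
\<close>

type_synonym ('x, 'k) mpoly = "('x \<Rightarrow>\<^sub>0 nat) \<Rightarrow>\<^sub>0 'k"

definition Var :: "'x \<Rightarrow> ('x, 'k::{zero,one}) mpoly" where
  "Var i = Poly_Mapping.single (Poly_Mapping.single i 1) 1"

definition Const :: "'k::zero \<Rightarrow> ('x, 'k) mpoly" where
  "Const c = Poly_Mapping.single 0 c"

text \<open>
  The third conjunct says that the ring is the internal direct sum of the \<open>G i\<close>: every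
  element has exactly one family of homogeneous components.
\<close>

definition nat_grading :: "(nat \<Rightarrow> 'r::comm_ring_1 set) \<Rightarrow> bool" where
  "nat_grading G \<longleftrightarrow>
     (\<forall>i. additive_subgroup (G i) ring_of_type_algebra) \<and>
     (\<forall>i j. \<forall>x\<in>G i. \<forall>y\<in>G j. x * y \<in> G (i + j)) \<and>
     (\<forall>x. \<exists>!h. (\<forall>i. h i \<in> G i) \<and> finite {i. h i \<noteq> 0} \<and> x = (\<Sum>i | h i \<noteq> 0. h i))"

definition homogeneous :: "(nat \<Rightarrow> 'r set) \<Rightarrow> 'r \<Rightarrow> bool" where
  "homogeneous G x \<longleftrightarrow> (\<exists>i. x \<in> G i)"

text \<open>For a subring \<open>A\<close>, this is the subring \<open>A[x]\<close> generated by \<open>A\<close> and \<open>x\<close>.\<close>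

definition adjoin :: "'r::comm_ring_1 set \<Rightarrow> 'r \<Rightarrow> 'r set" where
  "adjoin A x = {poly p x | p. \<forall>i. Polynomial.coeff p i \<in> A}"

definition quot_principal :: "'r::comm_ring_1 \<Rightarrow> 'r set ring" where
  "quot_principal g = ring_of_type_algebra Quot (PIdl\<^bsub>ring_of_type_algebra\<^esub> g)"

text \<open>The structure map of the \<open>'k\<close>-algebra \<open>R/gR\<close>, where \<open>R\<close> is the polynomial ring.\<close>

definition quot_scalar :: "('x, 'k::field) mpoly \<Rightarrow> 'k \<Rightarrow> ('x, 'k) mpoly set" where
  "quot_scalar g c =
     (PIdl\<^bsub>ring_of_type_algebra\<^esub> g) +>\<^bsub>ring_of_type_algebra\<^esub> Const c"

text \<open>The field \<open>'k\<close> acts on \<open>A\<close> through the structure map \<open>\<phi>\<close>.\<close>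

definition trivial_units :: "('k::field \<Rightarrow> 'a) \<Rightarrow> ('a, 'b) ring_scheme \<Rightarrow> bool" where
  "trivial_units \<phi> A \<longleftrightarrow> Units A = \<phi> ` (UNIV - {0})"

definition derivation :: "('a, 'b) ring_scheme \<Rightarrow> ('a \<Rightarrow> 'a) \<Rightarrow> bool" where
  "derivation A D \<longleftrightarrow>
     D \<in> carrier A \<rightarrow> carrier A \<and>
     (\<forall>a\<in>carrier A. \<forall>b\<in>carrier A.
        D (a \<oplus>\<^bsub>A\<^esub> b) = D a \<oplus>\<^bsub>A\<^esub> D b \<and>
        D (a \<otimes>\<^bsub>A\<^esub> b) = (D a \<otimes>\<^bsub>A\<^esub> b) \<oplus>\<^bsub>A\<^esub> (a \<otimes>\<^bsub>A\<^esub> D b))"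

definition locally_nilpotent :: "('a, 'b) ring_scheme \<Rightarrow> ('a \<Rightarrow> 'a) \<Rightarrow> bool" where
  "locally_nilpotent A D \<longleftrightarrow> (\<forall>b\<in>carrier A. \<exists>m>0. (D ^^ m) b = \<zero>\<^bsub>A\<^esub>)"

text \<open>Only the values of a derivation on the carrier are relevant.\<close>

definition rigid :: "('a, 'b) ring_scheme \<Rightarrow> bool" where
  "rigid A \<longleftrightarrow>
     (\<forall>D. derivation A D \<and> locally_nilpotent A D \<longrightarrow> (\<forall>b\<in>carrier A. D b = \<zero>\<^bsub>A\<^esub>))"

end

theory Submission
  imports Defs
begin

text \<open>
  Since \<open>f\<close> has positive degree, the leading form of a multiple of \<open>f - c\<close> is a multiple of the prime
  \<open>f\<close>. Modulo \<open>f - c\<close> every nonzero class therefore has a representative whose leading form is not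
  divisible by \<open>f\<close>, and multiplying such representatives shows that \<open>f - c\<close> is prime and that units
  modulo \<open>f - c\<close> are represented by units of the polynomial ring.

  It also follows that \<open>R/fR\<close> is the graded ring associated with the degree filtration of
  \<open>R/(f - c)R\<close>. A locally nilpotent derivation of the domain \<open>R/(f - c)R\<close> kills the units, in
  particular the scalars; hence the finitely many \<open>X\<^sub>i\<close> control by how much it shifts degrees. If it is
  nonzero, then taking the least shift and passing to leading forms gives a nonzero locally
  nilpotent derivation of \<open>R/fR\<close>.
\<close>

section \<open>Congruence modulo a ring element\<close>

definition cong_dvd :: "'r::comm_ring_1 \<Rightarrow> 'r \<Rightarrow> 'r \<Rightarrow> bool" where
  "cong_dvd g a b \<longleftrightarrow> g dvd a - b"

lemma cong_dvd_refl [simp, intro]: "cong_dvd g a a"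
  by (simp add: cong_dvd_def)

lemma cong_dvd_sym: "cong_dvd g a b \<Longrightarrow> cong_dvd g b a"
  unfolding cong_dvd_def by (metis dvd_minus_iff minus_diff_eq)

lemma cong_dvd_trans [trans]: "cong_dvd g a b \<Longrightarrow> cong_dvd g b c \<Longrightarrow> cong_dvd g a c"
  unfolding cong_dvd_def by (metis add_diff_eq diff_add_cancel dvd_add)

lemma cong_dvd_add: "cong_dvd g a b \<Longrightarrow> cong_dvd g a' b' \<Longrightarrow> cong_dvd g (a + a') (b + b')"
  unfolding cong_dvd_def by (metis add_diff_add dvd_add)

lemma cong_dvd_minus: "cong_dvd g a b \<Longrightarrow> cong_dvd g (- a) (- b)"
  unfolding cong_dvd_def by (metis dvd_minus_iff minus_diff_minus)

lemma cong_dvd_diff: "cong_dvd g a b \<Longrightarrow> cong_dvd g a' b' \<Longrightarrow> cong_dvd g (a - a') (b - b')"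
  using cong_dvd_add[of g a b "- a'" "- b'"] cong_dvd_minus[of g a' b'] by simp

lemma cong_dvd_mult:
  assumes "cong_dvd g a b" "cong_dvd g a' b'" shows "cong_dvd g (a * a') (b * b')"
proof -
  have "a * a' - b * b' = (a - b) * a' + b * (a' - b')" by (simp add: algebra_simps)
  then show ?thesis using assms unfolding cong_dvd_def by simp
qed

lemma cong_dvd_sum: "(\<And>i. i \<in> A \<Longrightarrow> cong_dvd g (u i) (v i)) \<Longrightarrow> cong_dvd g (sum u A) (sum v A)"
  by (induction A rule: infinite_finite_induct) (auto intro: cong_dvd_add)

lemma cong_dvd_0_iff: "cong_dvd g a 0 \<longleftrightarrow> g dvd a"
  by (simp add: cong_dvd_def)

subsection \<open>Derivations modulo an element\<close>

text \<open>Maps on a quotient \<open>R/gR\<close> are represented by maps on \<open>R\<close> whose identities hold modulo \<open>g\<close>.\<close>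

definition derivation_mod :: "'r::comm_ring_1 \<Rightarrow> ('r \<Rightarrow> 'r) \<Rightarrow> bool" where
  "derivation_mod g E \<longleftrightarrow>
     (\<forall>a b. cong_dvd g a b \<longrightarrow> cong_dvd g (E a) (E b)) \<and>
     (\<forall>a b. cong_dvd g (E (a + b)) (E a + E b)) \<and>
     (\<forall>a b. cong_dvd g (E (a * b)) (E a * b + a * E b))"

definition nilpotent_mod :: "'r::comm_ring_1 \<Rightarrow> ('r \<Rightarrow> 'r) \<Rightarrow> bool" where
  "nilpotent_mod g E \<longleftrightarrow> (\<forall>b. \<exists>m>0. g dvd (E ^^ m) b)"

definition rigid_mod :: "'r::comm_ring_1 \<Rightarrow> bool" where
  "rigid_mod g \<longleftrightarrow> (\<forall>E. derivation_mod g E \<and> nilpotent_mod g E \<longrightarrow> (\<forall>b. g dvd E b))"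

text \<open>The conditions of \<open>derivation_mod\<close> as a locale, because the general facts
  are needed twice: for \<open>E\<close> modulo \<open>f - c\<close> and for the induced map
  \<open>grE\<close> modulo \<open>f\<close>.\<close>

locale derivation_modulo =
  fixes g :: "'r::comm_ring_1" and E :: "'r \<Rightarrow> 'r"
  assumes E_cong: "cong_dvd g a b \<Longrightarrow> cong_dvd g (E a) (E b)"
    and E_add: "cong_dvd g (E (a + b)) (E a + E b)"
    and E_mult: "cong_dvd g (E (a * b)) (E a * b + a * E b)"
begin

lemma E_zero: "cong_dvd g (E 0) 0"
  using E_add[of 0 0] unfolding cong_dvd_def by (simp add: dvd_diff_commute)

lemma E_minus: "cong_dvd g (E (- a)) (- E a)"
proof -
  have "cong_dvd g (E a + E (- a)) 0"
    using cong_dvd_trans[OF cong_dvd_sym[OF E_add[of a "- a"]]] E_zero by simp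
  then show ?thesis by (simp add: cong_dvd_def add.commute)
qed

lemma E_diff: "cong_dvd g (E (a - b)) (E a - E b)"
  using cong_dvd_trans[OF E_add[of a "- b"] cong_dvd_add[OF cong_dvd_refl E_minus]] by simp

lemma funpow_cong: "cong_dvd g a b \<Longrightarrow> cong_dvd g ((E ^^ m) a) ((E ^^ m) b)"
  by (induction m) (auto intro: E_cong)

lemma funpow_zero: "cong_dvd g ((E ^^ m) 0) 0"
  by (induction m) (auto intro: E_zero E_cong cong_dvd_trans)

lemma funpow_add: "cong_dvd g ((E ^^ m) (a + b)) ((E ^^ m) a + (E ^^ m) b)"
proof (induction m)
  case (Suc m)
  show ?case using cong_dvd_trans[OF E_cong[OF Suc] E_add] by simp
qed simp

lemma funpow_dvd_mono: "g dvd (E ^^ m) a \<Longrightarrow> m \<le> n \<Longrightarrow> g dvd (E ^^ n) a"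
proof -
  assume "g dvd (E ^^ m) a" "m \<le> n"
  then have "cong_dvd g ((E ^^ (n - m)) ((E ^^ m) a)) ((E ^^ (n - m)) 0)"
    by (intro funpow_cong) (simp add: cong_dvd_0_iff)
  then have "cong_dvd g ((E ^^ (n - m)) ((E ^^ m) a)) 0"
    using funpow_zero cong_dvd_trans by blast
  moreover have "(E ^^ (n - m)) ((E ^^ m) a) = (E ^^ n) a"
    using \<open>m \<le> n\<close> by (metis comp_apply Nat.funpow_add le_add_diff_inverse2)
  ultimately show ?thesis by (simp add: cong_dvd_0_iff)
qed

text \<open>The leading term of the general Leibniz rule, with \<open>N\<close> a binomial coefficient.\<close>

lemma leading_leibniz:
  assumes "g dvd (E ^^ Suc m) a" "g dvd (E ^^ Suc n) b"
  shows "g dvd (E ^^ Suc (m + n)) (a * b) \<and>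
    (\<exists>N>0. cong_dvd g ((E ^^ (m + n)) (a * b)) (of_nat N * ((E ^^ m) a * (E ^^ n) b)))"
  using assms
proof (induction "m + n" arbitrary: m n a b rule: less_induct)
  case less
  \<comment> \<open>Induction on \<open>m + n\<close>: one application of \<open>E\<close> splits
    the product into two summands, each with a factor that needs one iterate fewer.\<close>
  have split: "cong_dvd g ((E ^^ Suc j) (a * b)) ((E ^^ j) (E a * b) + (E ^^ j) (a * E b))" for j
    using cong_dvd_trans[OF funpow_cong[OF E_mult] funpow_add] by (simp add: funpow_swap1)
  \<comment> \<open>For \<open>m = 0\<close> the induction hypothesis does not reach
    \<open>E a * b\<close>, but then \<open>E a\<close> vanishes modulo \<open>g\<close> and the
    summand with it. \<open>R\<close> is the mirror image for \<open>n = 0\<close>.\<close>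
  have L: "cong_dvd g ((E ^^ j) (E a * b)) 0" if "m = 0" for j
  proof -
    have "cong_dvd g (E a * b) 0" using less.prems(1) that by (simp add: cong_dvd_0_iff)
    then show ?thesis using funpow_cong funpow_zero cong_dvd_trans by blast
  qed
  have R: "cong_dvd g ((E ^^ j) (a * E b)) 0" if "n = 0" for j
  proof -
    have "cong_dvd g (a * E b) 0" using less.prems(2) that by (simp add: cong_dvd_0_iff)
    then show ?thesis using funpow_cong funpow_zero cong_dvd_trans by blast
  qed
  have L': "cong_dvd g ((E ^^ Suc (m' + n)) (E a * b)) 0 \<and>
      (\<exists>N>0. cong_dvd g ((E ^^ (m' + n)) (E a * b)) (of_nat N * ((E ^^ m) a * (E ^^ n) b)))"
    if "m = Suc m'" for m'
    using less.hyps[of m' n "E a" b] less.prems that by (simp add: funpow_swap1 cong_dvd_0_iff)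
  have R': "cong_dvd g ((E ^^ Suc (m + n')) (a * E b)) 0 \<and>
      (\<exists>N>0. cong_dvd g ((E ^^ (m + n')) (a * E b)) (of_nat N * ((E ^^ m) a * (E ^^ n) b)))"
    if "n = Suc n'" for n'
    using less.hyps[of m n' a "E b"] less.prems that by (simp add: funpow_swap1 cong_dvd_0_iff)
  have "cong_dvd g ((E ^^ (m + n)) (E a * b)) 0"
    using L L' by (cases m) auto
  moreover have "cong_dvd g ((E ^^ (m + n)) (a * E b)) 0"
    using R R' by (cases n) auto
  ultimately have "cong_dvd g ((E ^^ Suc (m + n)) (a * b)) 0"
    using cong_dvd_trans[OF split] cong_dvd_add by fastforce
  moreover have "\<exists>N>0. cong_dvd g ((E ^^ (m + n)) (a * b)) (of_nat N * ((E ^^ m) a * (E ^^ n) b))"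
  proof (cases "m + n")
    case 0
    then show ?thesis by (intro exI[of _ 1]) simp
  next
    case (Suc j)
    \<comment> \<open>Pascal's rule: the coefficients of the two summands are added. A vanishing
      summand gets coefficient 0; since \<open>m + n = Suc j\<close>, one of \<open>m\<close> and
      \<open>n\<close> is positive, which makes \<open>N1 + N2\<close> positive.\<close>
    have "\<exists>N. (m > 0 \<longrightarrow> N > 0) \<and> cong_dvd g ((E ^^ j) (E a * b)) (of_nat N * ((E ^^ m) a * (E ^^ n) b))"
    proof (cases m)
      case 0
      then show ?thesis using L by (intro exI[of _ 0]) simp
    next
      case m: (Suc m')
      then show ?thesis using L'[OF m] Suc by auto
    qed
    then obtain N1 where N1: "m > 0 \<longrightarrow> N1 > 0"
      "cong_dvd g ((E ^^ j) (E a * b)) (of_nat N1 * ((E ^^ m) a * (E ^^ n) b))" by blast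
    have "\<exists>N. (n > 0 \<longrightarrow> N > 0) \<and> cong_dvd g ((E ^^ j) (a * E b)) (of_nat N * ((E ^^ m) a * (E ^^ n) b))"
    proof (cases n)
      case 0
      then show ?thesis using R by (intro exI[of _ 0]) simp
    next
      case n: (Suc n')
      then show ?thesis using R'[OF n] Suc by auto
    qed
    then obtain N2 where N2: "n > 0 \<longrightarrow> N2 > 0"
      "cong_dvd g ((E ^^ j) (a * E b)) (of_nat N2 * ((E ^^ m) a * (E ^^ n) b))" by blast
    have "cong_dvd g ((E ^^ (m + n)) (a * b)) (of_nat (N1 + N2) * ((E ^^ m) a * (E ^^ n) b))"
      using cong_dvd_trans[OF split[of j] cong_dvd_add[OF N1(2) N2(2)]] Suc
      by (simp add: distrib_right)
    moreover have "N1 + N2 > 0" using N1(1) N2(1) Suc by auto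
    ultimately show ?thesis by blast
  qed
  ultimately show ?case by (simp add: cong_dvd_0_iff)
qed

text \<open>The exponent \<open>m\<close> is the degree of \<open>a\<close> with respect to
  \<open>E\<close>: one less than the first exponent at which the iterates vanish modulo
  \<open>g\<close>.\<close>

lemma nilpotent_last:
  assumes "nilpotent_mod g E" "\<not> g dvd a"
  obtains m where "\<not> g dvd (E ^^ m) a" "g dvd (E ^^ Suc m) a"
proof -
  let ?P = "\<lambda>m. g dvd (E ^^ m) a"
  have ex: "\<exists>m. ?P m" using assms(1) by (auto simp: nilpotent_mod_def)
  define k where "k = (LEAST m. ?P m)"
  have k: "?P k" unfolding k_def using ex by (rule LeastI_ex)
  then have "k \<noteq> 0" using assms(2) by (metis funpow_0)
  then obtain m where "k = Suc m" by (cases k) auto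
  then show ?thesis using that[of m] k not_less_Least[of m ?P] k_def by auto
qed

text \<open>Degrees with respect to \<open>E\<close> add up on products: by
  \<open>leading_leibniz\<close> the iterate of order \<open>m + n\<close> of \<open>u * v\<close>
  is a positive integer times two factors not divisible by the prime \<open>g\<close>. Invertibility
  of positive integers stands for characteristic 0. As \<open>E\<close> kills
  \<open>u * v = 1\<close>, both degrees are 0.\<close>

lemma nilpotent_kills_units:
  assumes "nilpotent_mod g E" "prime_elem g" "\<And>n. n > 0 \<Longrightarrow> of_nat n dvd (1::'r)"
    and uv: "u * v = 1"
  shows "g dvd E u"
proof -
  have g1: "\<not> g dvd 1" using assms(2) by (simp add: prime_elem_def)
  have "\<not> g dvd u" "\<not> g dvd v" using g1 uv by (metis dvd_mult2 dvd_mult)+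
  then obtain m n where m: "\<not> g dvd (E ^^ m) u" "g dvd (E ^^ Suc m) u"
    and n: "\<not> g dvd (E ^^ n) v" "g dvd (E ^^ Suc n) v"
    using nilpotent_last assms(1) by metis
  obtain N where N: "N > 0" "cong_dvd g ((E ^^ (m + n)) (u * v)) (of_nat N * ((E ^^ m) u * (E ^^ n) v))"
    using leading_leibniz[OF m(2) n(2)] by blast
  have "\<not> g dvd of_nat N" using assms(3)[OF N(1)] g1 dvd_trans by blast
  then have nd: "\<not> g dvd of_nat N * ((E ^^ m) u * (E ^^ n) v)"
    using m(1) n(1) by (simp add: prime_elem_dvd_mult_iff[OF assms(2)])
  have E1: "g dvd E 1" using E_mult[of 1 1] by (simp add: cong_dvd_def dvd_diff_commute)
  have "m + n = 0"
  proof (rule ccontr)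
    assume "m + n \<noteq> 0"
    then have "g dvd (E ^^ (m + n)) 1" using funpow_dvd_mono[of 1 1 "m + n"] E1 by (simp add: Suc_le_eq)
    then have "g dvd of_nat N * ((E ^^ m) u * (E ^^ n) v)"
      using N(2) uv cong_dvd_trans cong_dvd_sym cong_dvd_0_iff by metis
    with nd show False by blast
  qed
  then show ?thesis using m(2) by simp
qed

end

lemma derivation_modulo_iff: "derivation_modulo g E \<longleftrightarrow> derivation_mod g E"
  by (auto simp: derivation_modulo_def derivation_mod_def)

subsection \<open>Leading forms in a graded domain\<close>

text \<open>Components are indexed by integers so that degrees may be shifted freely.\<close>

locale graded_domain =
  fixes cmp :: "int \<Rightarrow> 'r::comm_ring_1 \<Rightarrow> 'r"
  assumes cmp_add: "cmp k (x + y) = cmp k x + cmp k y"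
    and finite_support: "finite {k. cmp k x \<noteq> 0}"
    and sum_cmp: "(\<Sum>k | cmp k x \<noteq> 0. cmp k x) = x"
    and cmp_cmp: "cmp j (cmp k x) = (if j = k then cmp k x else 0)"
    and cmp_mult_cmp: "cmp (i + j) (cmp i x * cmp j y) = cmp i x * cmp j y"
    and cmp_neg: "k < 0 \<Longrightarrow> cmp k x = 0"
    and no_zero_div: "x * y = 0 \<Longrightarrow> x = 0 \<or> y = 0"
begin

definition homog :: "int \<Rightarrow> 'r \<Rightarrow> bool" where
  "homog k x \<longleftrightarrow> cmp k x = x"

text \<open>Only an upper bound for the degree: \<open>cmp n x\<close> may vanish. Thus the elements
  bounded by \<open>n\<close> form an additive group containing 0, a step of the degree
  filtration.\<close>

definition bounded :: "int \<Rightarrow> 'r \<Rightarrow> bool" where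
  "bounded n x \<longleftrightarrow> (\<forall>k>n. cmp k x = 0)"

lemma cmp_0 [simp]: "cmp k 0 = 0"
  using cmp_add[of k 0 0] by simp

lemma cmp_minus [simp]: "cmp k (- x) = - cmp k x"
  using cmp_add[of k x "- x"] by (simp add: eq_neg_iff_add_eq_0 add.commute)

lemma cmp_diff: "cmp k (x - y) = cmp k x - cmp k y"
  using cmp_add[of k x "- y"] by simp

lemma cmp_sum: "cmp k (sum u A) = (\<Sum>i\<in>A. cmp k (u i))"
  by (induction A rule: infinite_finite_induct) (auto simp: cmp_add)

lemma homog_cmp_eq: "homog k x \<Longrightarrow> cmp j x = (if j = k then x else 0)"
  unfolding homog_def using cmp_cmp[of j k x] by auto

lemma homog_cmp [simp]: "homog k (cmp k x)"
  by (simp add: homog_def cmp_cmp)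

lemma homog_0 [simp]: "homog k 0"
  by (simp add: homog_def)

lemma homog_mult: "homog i x \<Longrightarrow> homog j y \<Longrightarrow> homog (i + j) (x * y)"
  unfolding homog_def by (metis cmp_mult_cmp)

lemma homog_induct [case_names homog add]:
  assumes "\<And>i r. homog i r \<Longrightarrow> P r" "\<And>x y. P x \<Longrightarrow> P y \<Longrightarrow> P (x + y)"
  shows "P x"
proof -
  have "P (sum (\<lambda>k. cmp k x) A)" for A
    by (induction A rule: infinite_finite_induct) (auto intro: assms(2) assms(1)[OF homog_cmp] assms(1)[OF homog_0])
  then show ?thesis using sum_cmp[of x] by metis
qed

lemma cmp_mult_homog: "homog j y \<Longrightarrow> cmp k (x * y) = cmp (k - j) x * y"
proof (induction x rule: homog_induct)
  case (homog i r)
  then show ?case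
    using homog_cmp_eq[OF homog_mult[OF homog], of k] homog_cmp_eq[OF homog(1), of "k - j"] by auto
next
  case (add x y)
  then show ?case by (simp add: distrib_right cmp_add)
qed

lemma cmp_mult: "cmp k (x * y) = (\<Sum>j | cmp j y \<noteq> 0. cmp (k - j) x * cmp j y)"
proof -
  have "x * y = (\<Sum>j | cmp j y \<noteq> 0. x * cmp j y)"
    by (metis sum_cmp sum_distrib_left)
  then show ?thesis by (simp add: cmp_sum cmp_mult_homog[OF homog_cmp])
qed

lemma bounded_0 [simp]: "bounded n 0"
  by (simp add: bounded_def)

lemma bounded_le: "bounded n x \<Longrightarrow> cmp k x \<noteq> 0 \<Longrightarrow> k \<le> n"
  unfolding bounded_def using not_le by blast

lemma homog_bounded: "homog k x \<Longrightarrow> k \<le> n \<Longrightarrow> bounded n x"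
  by (simp add: bounded_def homog_cmp_eq)

lemma bounded_mono: "bounded n x \<Longrightarrow> n \<le> m \<Longrightarrow> bounded m x"
  by (simp add: bounded_def)

lemma bounded_add: "bounded n x \<Longrightarrow> bounded n y \<Longrightarrow> bounded n (x + y)"
  by (simp add: bounded_def cmp_add)

lemma bounded_diff: "bounded n x \<Longrightarrow> bounded n y \<Longrightarrow> bounded n (x - y)"
  by (simp add: bounded_def cmp_diff)

lemma bounded_pred: "bounded n x \<Longrightarrow> cmp n x = 0 \<Longrightarrow> bounded (n - 1) x"
  unfolding bounded_def by (metis linorder_neqE zle_diff1_eq not_less)

lemma bounded_mult:
  assumes "bounded m x" "bounded n y" shows "bounded (m + n) (x * y)"
  unfolding bounded_def
proof (intro allI impI)
  fix k assume k: "k > m + n"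
  have "cmp (k - j) x * cmp j y = 0" for j
  proof (cases "j > n")
    case True then show ?thesis using assms(2) by (simp add: bounded_def)
  next
    case False
    then have "k - j > m" using k by linarith
    then show ?thesis using assms(1) by (simp add: bounded_def)
  qed
  then show "cmp k (x * y) = 0" by (simp add: cmp_mult)
qed

text \<open>In the sum for the product only \<open>j = n\<close> survives: larger \<open>j\<close>
  exceed the bound of \<open>y\<close>, smaller ones push the other index above
  \<open>m\<close>.\<close>

lemma cmp_mult_top:
  assumes "bounded m x" "bounded n y" shows "cmp (m + n) (x * y) = cmp m x * cmp n y"
proof -
  have "cmp (m + n) (x * y) = (\<Sum>j | cmp j y \<noteq> 0. if j = n then cmp m x * cmp n y else 0)"
    unfolding cmp_mult
  proof (rule sum.cong, goal_cases)
    case (2 j)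
    then have "j \<le> n" using bounded_le[OF assms(2)] by simp
    moreover have "cmp (m + n - j) x = 0" if "j < n"
      using assms(1) that by (simp add: bounded_def)
    ultimately show ?case by auto
  qed simp
  also have "\<dots> = cmp m x * cmp n y" using finite_support[of y] by auto
  finally show ?thesis .
qed

lemma bounded_neg: "bounded n x \<Longrightarrow> n < 0 \<Longrightarrow> x = 0"
proof -
  assume "bounded n x" "n < 0"
  then have "cmp k x = 0" for k
    using cmp_neg[of k x] by (cases "k < 0") (auto simp: bounded_def)
  then show ?thesis using sum_cmp[of x] by simp
qed

lemma bounded_0_homog: "bounded 0 x \<Longrightarrow> homog 0 x"
proof -
  assume "bounded 0 x"
  then have "cmp k x = 0" if "k \<noteq> 0" for k
    using cmp_neg[of k x] that by (cases "k < 0") (auto simp: bounded_def)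
  then have "(\<Sum>k | cmp k x \<noteq> 0. cmp k x) = (\<Sum>k\<in>{0}. cmp k x)"
    using finite_support[of x] by (intro sum.mono_neutral_left) auto
  then show ?thesis using sum_cmp[of x] by (simp add: homog_def)
qed

lemma obtain_degree:
  assumes "x \<noteq> 0"
  obtains n where "bounded n x" "cmp n x \<noteq> 0" "n \<ge> 0"
proof -
  let ?S = "{k. cmp k x \<noteq> 0}"
  have "?S \<noteq> {}" using assms sum_cmp[of x] by force
  then have M: "Max ?S \<in> ?S" using finite_support by (intro Max_in)
  moreover have "bounded (Max ?S) x" unfolding bounded_def
    using Max_ge[OF finite_support[of x]] by (force simp: not_le[symmetric])
  moreover have "Max ?S \<ge> 0" using M cmp_neg[of "Max ?S" x] by force
  ultimately show ?thesis using that by blast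
qed

text \<open>If \<open>n\<close> is the degree of 1, then \<open>1 * 1 = 1\<close> has a nonzero
  component in degree \<open>n + n\<close>, which forces \<open>n + n \<le> n\<close>.\<close>

lemma homog_1: "homog 0 1"
proof -
  obtain n where n: "bounded n 1" "cmp n 1 \<noteq> 0" "n \<ge> 0"
    using obtain_degree[of 1] by auto
  have "cmp (n + n) 1 \<noteq> 0"
    using cmp_mult_top[OF n(1) n(1)] n(2) no_zero_div by (metis mult_1)
  then have "n = 0" using bounded_le[OF n(1)] n(3) by force
  then show ?thesis using n bounded_0_homog by blast
qed

text \<open>Degrees are nonnegative and add up in a domain, so both factors of 1 have degree
  0.\<close>

lemma unit_homog_0:
  assumes "x * y = 1" shows "homog 0 x"
proof -
  have "x \<noteq> 0" "y \<noteq> 0" using assms by auto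
  obtain m where m: "bounded m x" "cmp m x \<noteq> 0" "m \<ge> 0"
    using obtain_degree[OF \<open>x \<noteq> 0\<close>] .
  obtain n where n: "bounded n y" "cmp n y \<noteq> 0" "n \<ge> 0"
    using obtain_degree[OF \<open>y \<noteq> 0\<close>] .
  have "cmp (m + n) 1 \<noteq> 0"
    using cmp_mult_top[OF m(1) n(1)] m n no_zero_div assms by metis
  then have "m = 0" using m n homog_cmp_eq[OF homog_1] by (metis add_nonneg_eq_0_iff)
  then show ?thesis using m bounded_0_homog by blast
qed

end

section \<open>The element \<open>g = f - c\<close> as a deformation of the homogeneous prime
  \<open>f\<close>\<close>

locale graded_deformation = graded_domain cmp for cmp :: "int \<Rightarrow> 'r::comm_ring_1 \<Rightarrow> 'r" +
  fixes f c g :: 'r and d :: int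
  assumes g_def: "g = f - c"
    and homog_f: "homog d f" and d_pos: "d > 0" and prime_f: "prime_elem f"
    and homog_c: "homog 0 c"
begin

lemma f_nz: "f \<noteq> 0" using prime_f by (simp add: prime_elem_def)

lemma bounded_g: "bounded d g"
  unfolding g_def using homog_f homog_c d_pos by (intro bounded_diff homog_bounded) auto

lemma cmp_g: "cmp d g = f"
  unfolding g_def using homog_cmp_eq[OF homog_f] homog_cmp_eq[OF homog_c] d_pos
  by (simp add: cmp_diff)

text \<open>The leading form of \<open>g\<close> is \<open>f\<close>, of degree \<open>d\<close>;
  leading forms multiply to something nonzero in a domain, so a nonzero \<open>q\<close> has degree
  exactly \<open>d\<close> less than \<open>g * q\<close>.\<close>

lemma bounded_cofactor:
  assumes "bounded n (g * q)" shows "bounded (n - d) q"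
proof (cases "q = 0")
  case False
  then obtain m where m: "bounded m q" "cmp m q \<noteq> 0" using obtain_degree by blast
  have "cmp (d + m) (g * q) \<noteq> 0"
    using cmp_mult_top[OF bounded_g m(1)] m(2) f_nz no_zero_div cmp_g by metis
  then have "d + m \<le> n" using bounded_le[OF assms] by simp
  then show ?thesis using m(1) bounded_mono by force
qed simp

text \<open>The cofactor of \<open>g\<close> in \<open>x\<close> is bounded by \<open>n - d\<close>,
  so the degree \<open>n\<close> component of the product is \<open>f\<close> times a component of
  the cofactor.\<close>

lemma leading_form_dvd:
  assumes "bounded n x" "g dvd x" shows "f dvd cmp n x"
proof -
  obtain q where q: "x = g * q" using assms(2) by (auto elim: dvdE)
  then have "cmp (d + (n - d)) x = f * cmp (n - d) q"
    using cmp_mult_top[OF bounded_g bounded_cofactor] assms(1) cmp_g by metis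
  then show ?thesis by simp
qed

lemma leading_form_cancel:
  assumes "bounded n x" "f dvd cmp n x"
  obtains y where "bounded (n - 1) y" "cong_dvd g x y"
proof -
  obtain a where a: "cmp n x = f * a" using assms(2) by (auto elim: dvdE)
  \<comment> \<open>The cofactor \<open>a\<close> need not be homogeneous; comparing components of
    degree \<open>n\<close> replaces it by its component of degree \<open>n - d\<close>. Subtracting
    \<open>g\<close> times that component removes the leading form.\<close>
  have "f * cmp (n - d) a = cmp n (f * a)"
    using cmp_mult_homog[OF homog_f, of n a] by (simp add: mult.commute)
  then have fa: "f * cmp (n - d) a = cmp n x"
    by (metis a cmp_cmp)
  have b: "bounded (n - d) (cmp (n - d) a)" by (rule homog_bounded[OF homog_cmp]) simp
  have "bounded n (x - g * cmp (n - d) a)"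
    using bounded_diff[OF assms(1)] bounded_mult[OF bounded_g b] by simp
  moreover have "cmp n (x - g * cmp (n - d) a) = 0"
    using cmp_mult_top[OF bounded_g b] fa cmp_g by (simp add: cmp_diff cmp_cmp)
  ultimately have "bounded (n - 1) (x - g * cmp (n - d) a)" by (rule bounded_pred)
  then show ?thesis using that by (force simp: cong_dvd_def)
qed

text \<open>Repeated use of \<open>leading_form_cancel\<close> lowers the bound as long as
  \<open>f\<close> divides the top component. The descent cannot pass degree 0: the representative
  would become 0, and \<open>g\<close> would divide \<open>x\<close>.\<close>

lemma obtain_reduced:
  assumes "\<not> g dvd x"
  obtains m y where "cong_dvd g x y" "bounded m y" "\<not> f dvd cmp m y" "m \<ge> 0"
proof -
  have "\<exists>m y. cong_dvd g x y \<and> bounded m y \<and> \<not> f dvd cmp m y \<and> m \<ge> 0"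
    if "bounded (int n) x" "\<not> g dvd x" for n x using that
  proof (induction n arbitrary: x)
    case 0
    show ?case
    proof (cases "f dvd cmp 0 x")
      case True
      then obtain y where "bounded (0 - 1) y" "cong_dvd g x y"
        using leading_form_cancel[of 0 x] 0 by auto
      then show ?thesis using bounded_neg[of "- 1" y] 0 by (simp add: cong_dvd_0_iff)
    next
      case False then show ?thesis using 0 by auto
    qed
  next
    case (Suc n)
    show ?case
    proof (cases "f dvd cmp (int (Suc n)) x")
      case True
      then obtain y where y: "bounded (int (Suc n) - 1) y" "cong_dvd g x y"
        using leading_form_cancel Suc.prems(1) by blast
      then have "\<not> g dvd y"
        using Suc.prems(2) cong_dvd_trans cong_dvd_0_iff by metis
      then show ?thesis using Suc.IH[of y] y cong_dvd_trans by (simp, blast)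
    next
      case False then show ?thesis using Suc.prems by (metis cong_dvd_refl of_nat_0_le_iff)
    qed
  qed
  moreover have "x \<noteq> 0" using assms by auto
  then obtain n where "bounded n x" "n \<ge> 0" using obtain_degree by metis
  ultimately show ?thesis using that assms by (metis nonneg_int_cases)
qed

lemma g_nz: "g \<noteq> 0"
  using cmp_g f_nz by auto

lemma g_not_unit: "\<not> g dvd 1"
proof
  assume "g dvd 1"
  then have "homog 0 g" using unit_homog_0 by (metis dvdE)
  then show False using homog_cmp_eq[of 0 g d] cmp_g f_nz d_pos by simp
qed

lemma prime_g: "prime_elem g"
proof (rule prime_elemI)
  fix a b assume ab: "g dvd a * b"
  show "g dvd a \<or> g dvd b"
  proof (rule ccontr)
    assume *: "\<not> (g dvd a \<or> g dvd b)"
    obtain m r where r: "cong_dvd g a r" "bounded m r" "\<not> f dvd cmp m r"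
      using obtain_reduced * by metis
    obtain n s where s: "cong_dvd g b s" "bounded n s" "\<not> f dvd cmp n s"
      using obtain_reduced * by metis
    have "g dvd r * s"
      using ab cong_dvd_mult[OF r(1) s(1)] cong_dvd_trans cong_dvd_sym cong_dvd_0_iff by metis
    then have "f dvd cmp m r * cmp n s"
      using leading_form_dvd[OF bounded_mult[OF r(2) s(2)]] cmp_mult_top[OF r(2) s(2)] by simp
    then show False using r(3) s(3) prime_f prime_elem_dvd_multD by blast
  qed
qed (use g_nz g_not_unit in auto)

lemma unit_modulo:
  assumes "cong_dvd g (a * b) 1"
  obtains u v where "cong_dvd g a u" "u * v = 1"
proof -
  have "\<not> g dvd a * b"
    using assms g_not_unit cong_dvd_trans cong_dvd_sym cong_dvd_0_iff by metis
  then have "\<not> g dvd a" "\<not> g dvd b" by auto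
  then obtain m n r s where r: "cong_dvd g a r" "bounded m r" "\<not> f dvd cmp m r" "m \<ge> 0"
    and s: "cong_dvd g b s" "bounded n s" "\<not> f dvd cmp n s" "n \<ge> 0"
    using obtain_reduced by metis
  have rs: "g dvd r * s - 1"
    using assms cong_dvd_mult[OF r(1) s(1)] cong_dvd_trans cong_dvd_sym cong_dvd_def by metis
  have bd: "bounded (m + n) (r * s - 1)"
    using bounded_mult[OF r(2) s(2)] homog_bounded[OF homog_1] r(4) s(4) by (intro bounded_diff) auto
  have "m + n = 0"
  proof (rule ccontr)
    assume "m + n \<noteq> 0"
    then have "cmp (m + n) (r * s - 1) = cmp m r * cmp n s"
      using cmp_mult_top[OF r(2) s(2)] homog_cmp_eq[OF homog_1] by (simp add: cmp_diff)
    then have "f dvd cmp m r * cmp n s" using leading_form_dvd[OF bd rs] by simp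
    then show False using r(3) s(3) prime_f prime_elem_dvd_multD by blast
  qed
  moreover obtain q where q: "r * s - 1 = g * q" using rs by (auto elim: dvdE)
  \<comment> \<open>A multiple of \<open>g\<close> bounded by degree 0 has a cofactor bounded by a
    negative degree, so the congruence \<open>r * s = 1\<close> is an equality in the ring.\<close>
  ultimately have "bounded (- d) q" using bounded_cofactor[of 0 q] bd by simp
  then have "q = 0" using bounded_neg d_pos by force
  then show ?thesis using that r(1) q by simp
qed

end

subsection \<open>The derivation induced on the associated graded ring\<close>

locale filtered_derivation = graded_deformation cmp f c g d + derivation_modulo g E
  for cmp :: "int \<Rightarrow> 'r::comm_ring_1 \<Rightarrow> 'r" and f c g d and E :: "'r \<Rightarrow> 'r"
begin

text \<open>\<open>E x\<close> matters only modulo \<open>g\<close>, so the bound is asked of some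
  representative. This is the degree filtration of \<open>R/gR\<close>.\<close>

definition image_bounded :: "int \<Rightarrow> 'r \<Rightarrow> bool" where
  "image_bounded n x \<longleftrightarrow> (\<exists>e. bounded n e \<and> cong_dvd g (E x) e)"

text \<open>Imposed on every homogeneous component, the condition survives sums in which leading
  forms cancel. Being closed under sums and products, it can be checked on generators.\<close>

definition shift_at_most :: "int \<Rightarrow> 'r \<Rightarrow> bool" where
  "shift_at_most N x \<longleftrightarrow> (\<forall>k. image_bounded (k + N) (cmp k x))"

lemma image_bounded_0: "image_bounded n 0"
  unfolding image_bounded_def using E_zero bounded_0 by blast

lemma image_bounded_add: "image_bounded n x \<Longrightarrow> image_bounded n y \<Longrightarrow> image_bounded n (x + y)"
  unfolding image_bounded_def by (meson E_add bounded_add cong_dvd_add cong_dvd_trans)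

lemma image_bounded_sum: "(\<And>i. i \<in> A \<Longrightarrow> image_bounded n (u i)) \<Longrightarrow> image_bounded n (sum u A)"
  by (induction A rule: infinite_finite_induct) (auto intro: image_bounded_add image_bounded_0)

lemma image_bounded_mono: "image_bounded n x \<Longrightarrow> n \<le> m \<Longrightarrow> image_bounded m x"
  unfolding image_bounded_def using bounded_mono by blast

lemma image_bounded_mult_homog:
  assumes "image_bounded (i + N) x" "homog i x" "image_bounded (j + N) y" "homog j y"
  shows "image_bounded (i + j + N) (x * y)"
proof -
  obtain a where a: "bounded (i + N) a" "cong_dvd g (E x) a"
    using assms(1) by (auto simp: image_bounded_def)
  obtain b where b: "bounded (j + N) b" "cong_dvd g (E y) b"
    using assms(3) by (auto simp: image_bounded_def)
  have "cong_dvd g (E (x * y)) (a * y + x * b)"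
    using a(2) b(2) by (intro cong_dvd_trans[OF E_mult] cong_dvd_add cong_dvd_mult) auto
  moreover have "bounded (i + j + N) (a * y)"
    using bounded_mult[OF a(1) homog_bounded[OF assms(4) order_refl]] by (simp add: ac_simps)
  moreover have "bounded (i + j + N) (x * b)"
    using bounded_mult[OF homog_bounded[OF assms(2) order_refl] b(1)] by (simp add: ac_simps)
  ultimately show ?thesis unfolding image_bounded_def using bounded_add by blast
qed

lemma shift_at_most_add: "shift_at_most N x \<Longrightarrow> shift_at_most N y \<Longrightarrow> shift_at_most N (x + y)"
  by (simp add: shift_at_most_def cmp_add image_bounded_add)

lemma shift_at_most_mono: "shift_at_most N x \<Longrightarrow> N \<le> M \<Longrightarrow> shift_at_most M x"
  unfolding shift_at_most_def using image_bounded_mono by (metis add_left_mono)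

lemma shift_at_most_mult:
  assumes "shift_at_most N x" "shift_at_most N y" shows "shift_at_most N (x * y)"
  unfolding shift_at_most_def
proof
  fix k
  have "image_bounded (k + N) (cmp (k - j) x * cmp j y)" for j
    using image_bounded_mult_homog[of "k - j" N "cmp (k - j) x" j "cmp j y"] assms
    by (simp add: shift_at_most_def)
  then show "image_bounded (k + N) (cmp k (x * y))"
    by (simp add: cmp_mult image_bounded_sum)
qed

lemma shift_at_most_homog_iff: "homog i x \<Longrightarrow> shift_at_most N x \<longleftrightarrow> image_bounded (i + N) x"
  unfolding shift_at_most_def by (auto simp: homog_cmp_eq image_bounded_0 split: if_splits)

lemma ex_shift_homog:
  assumes "homog i x" shows "\<exists>N. shift_at_most N x"
proof (cases "E x = 0")
  case True
  then show ?thesis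
    using assms by (auto simp: shift_at_most_homog_iff image_bounded_def intro!: exI[of _ 0])
next
  case False
  then obtain n where "bounded n (E x)" using obtain_degree by blast
  then show ?thesis
    using assms by (auto simp: shift_at_most_homog_iff image_bounded_def intro!: exI[of _ "n - i"])
qed

lemma image_bounded_bounded:
  assumes "\<And>x. shift_at_most N x" "bounded n x" shows "image_bounded (n + N) x"
proof -
  have "image_bounded (n + N) (cmp k x)" if "cmp k x \<noteq> 0" for k
    using assms(1)[of x] image_bounded_mono[of "k + N" "cmp k x" "n + N"] bounded_le[OF assms(2) that]
    by (simp add: shift_at_most_def)
  then have "image_bounded (n + N) (\<Sum>k | cmp k x \<noteq> 0. cmp k x)"
    by (intro image_bounded_sum) simp
  then show ?thesis by (simp add: sum_cmp)
qed

text \<open>Shifts are bounded below: a homogeneous \<open>r\<close> of degree \<open>i\<close> with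
  \<open>E r\<close> nonzero modulo \<open>g\<close> forces \<open>i + M \<ge> 0\<close> for every
  shift \<open>M\<close> valid on the whole ring, because only 0 is bounded by a negative
  degree.\<close>

lemma obtain_least_shift:
  assumes N: "\<And>x. shift_at_most N x" and b: "\<not> g dvd E b"
  obtains \<delta> where "\<And>x. shift_at_most \<delta> x" "\<exists>x. \<not> shift_at_most (\<delta> - 1) x"
proof -
  have "\<exists>i r. homog i r \<and> \<not> g dvd E r"
  proof (rule ccontr)
    assume "\<nexists>i r. homog i r \<and> \<not> g dvd E r"
    then have *: "homog i r \<Longrightarrow> cong_dvd g (E r) 0" for i r by (auto simp: cong_dvd_0_iff)
    have "cong_dvd g (E x) 0" for x
    proof (induction x rule: homog_induct)
      case (add x y)
      then show ?case using cong_dvd_trans[OF E_add cong_dvd_add] by fastforce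
    qed (rule *)
    with b show False by (simp add: cong_dvd_0_iff)
  qed
  then obtain i r where r: "homog i r" "\<not> g dvd E r" by blast
  \<comment> \<open>The offset by \<open>i\<close> turns the valid shifts into natural numbers, so
    that a least one exists.\<close>
  let ?P = "\<lambda>n. \<forall>x. shift_at_most (int n - i) x"
  have ge: "i + M \<ge> 0" if M: "\<And>x. shift_at_most M x" for M
  proof (rule ccontr)
    assume "\<not> i + M \<ge> 0"
    moreover obtain e where "bounded (i + M) e" "cong_dvd g (E r) e"
      using M[of r] r(1) by (auto simp: shift_at_most_homog_iff image_bounded_def)
    ultimately have "cong_dvd g (E r) 0" using bounded_neg by (metis not_le)
    with r(2) show False by (simp add: cong_dvd_0_iff)
  qed
  have ex: "?P (nat (i + N))" using N ge[OF N] by simp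
  define n where "n = (LEAST n. ?P n)"
  have n: "?P n" unfolding n_def using ex by (rule LeastI)
  have "\<not> (\<forall>x. shift_at_most (int n - i - 1) x)"
  proof (cases n)
    \<comment> \<open>Here the next smaller shift is \<open>- i - 1\<close>, which \<open>ge\<close>
      excludes.\<close>
    case 0
    then show ?thesis using ge[of "int n - i - 1"] by auto
  next
    case (Suc m)
    then have "\<not> ?P m" using not_less_Least[of m ?P] n_def by simp
    then show ?thesis using Suc by (simp add: algebra_simps)
  qed
  with n that show ?thesis by blast
qed

end

text \<open>\<open>shift\<close> provides the representatives whose leading forms define
  \<open>lead\<close>, \<open>E_c\<close> makes the induced map vanish on \<open>f\<close>, and
  \<open>shift_least\<close> makes it nonzero.\<close>

locale least_shift = filtered_derivation cmp f c g d E
  for cmp :: "int \<Rightarrow> 'r::comm_ring_1 \<Rightarrow> 'r" and f c g d and E :: "'r \<Rightarrow> 'r" +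
  fixes \<delta> :: int
  assumes E_c: "g dvd E c"
    and shift: "shift_at_most \<delta> x"
    and shift_least: "\<exists>x. \<not> shift_at_most (\<delta> - 1) x"
begin

text \<open>Modulo \<open>f\<close>, the value of \<open>lead\<close> does not depend on the choice of \<open>e\<close>.\<close>

definition lead :: "int \<Rightarrow> 'r \<Rightarrow> 'r" where
  "lead i r = cmp (i + \<delta>) (SOME e. bounded (i + \<delta>) e \<and> cong_dvd g (E r) e)"

text \<open>The map induced on the associated graded ring \<open>R/fR\<close>, of degree
  \<open>\<delta>\<close>. Its values are meaningful only modulo \<open>f\<close>, because
  \<open>lead\<close> involves a choice.\<close>

definition grE :: "'r \<Rightarrow> 'r" where
  "grE x = (\<Sum>i | cmp i x \<noteq> 0. lead i (cmp i x))"

lemma leading_form_cong: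
  assumes "bounded n x" "bounded n y" "cong_dvd g x y"
  shows "cong_dvd f (cmp n x) (cmp n y)"
  using leading_form_dvd[OF bounded_diff[OF assms(1,2)]] assms(3) by (simp add: cong_dvd_def cmp_diff)

lemma obtain_image:
  assumes "bounded n x" obtains e where "bounded (n + \<delta>) e" "cong_dvd g (E x) e"
  using image_bounded_bounded[OF shift assms] by (auto simp: image_bounded_def)

lemma lead_cong:
  assumes "bounded (i + \<delta>) e" "cong_dvd g (E r) e"
  shows "cong_dvd f (lead i r) (cmp (i + \<delta>) e)"
proof -
  let ?e = "SOME e. bounded (i + \<delta>) e \<and> cong_dvd g (E r) e"
  have "bounded (i + \<delta>) ?e \<and> cong_dvd g (E r) ?e"
    using assms by (rule_tac someI[of _ e]) blast
  then show ?thesis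
    unfolding lead_def using assms leading_form_cong cong_dvd_trans cong_dvd_sym by metis
qed

lemma lead_0: "cong_dvd f (lead i 0) 0"
  using lead_cong[of i 0 0] E_zero by simp

text \<open>Additional indices contribute \<open>lead i 0\<close>, which depends on a choice and is
  only known to be 0 modulo \<open>f\<close>; hence a congruence in place of an equality.\<close>

lemma grE_superset:
  assumes "finite A" "{i. cmp i x \<noteq> 0} \<subseteq> A"
  shows "cong_dvd f (grE x) (\<Sum>i\<in>A. lead i (cmp i x))"
proof -
  have "grE x = (\<Sum>i\<in>A. if cmp i x \<noteq> 0 then lead i (cmp i x) else 0)"
    unfolding grE_def using assms by (intro sum.mono_neutral_cong_left) auto
  also have "cong_dvd f \<dots> (\<Sum>i\<in>A. lead i (cmp i x))"
    by (intro cong_dvd_sum) (auto intro: cong_dvd_sym lead_0)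
  finally show ?thesis .
qed

lemma grE_homog:
  assumes "homog i r" "bounded (i + \<delta>) e" "cong_dvd g (E r) e"
  shows "cong_dvd f (grE r) (cmp (i + \<delta>) e)"
proof -
  have "{k. cmp k r \<noteq> 0} \<subseteq> {i}" using homog_cmp_eq[OF assms(1)] by auto
  then have "cong_dvd f (grE r) (lead i r)"
    using grE_superset[of "{i}" r] homog_cmp_eq[OF assms(1)] by simp
  then show ?thesis using lead_cong[OF assms(2,3)] cong_dvd_trans by blast
qed

lemma lead_add:
  assumes "homog i x" "homog i y"
  shows "cong_dvd f (lead i (x + y)) (lead i x + lead i y)"
proof -
  obtain a where a: "bounded (i + \<delta>) a" "cong_dvd g (E x) a"
    using obtain_image homog_bounded[OF assms(1) order_refl] by blast
  obtain b where b: "bounded (i + \<delta>) b" "cong_dvd g (E y) b"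
    using obtain_image homog_bounded[OF assms(2) order_refl] by blast
  have "cong_dvd g (E (x + y)) (a + b)"
    using cong_dvd_trans[OF E_add cong_dvd_add[OF a(2) b(2)]] .
  then have "cong_dvd f (lead i (x + y)) (cmp (i + \<delta>) a + cmp (i + \<delta>) b)"
    using lead_cong bounded_add[OF a(1) b(1)] cmp_add by metis
  then show ?thesis
    using cong_dvd_add[OF lead_cong[OF a] lead_cong[OF b]] cong_dvd_trans cong_dvd_sym by blast
qed

lemma grE_add: "cong_dvd f (grE (x + y)) (grE x + grE y)"
proof -
  let ?A = "{i. cmp i x \<noteq> 0} \<union> {i. cmp i y \<noteq> 0}"
  have A: "finite ?A" using finite_support by blast
  have "cong_dvd f (grE (x + y)) (\<Sum>i\<in>?A. lead i (cmp i (x + y)))"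
    by (rule grE_superset[OF A]) (auto simp: cmp_add)
  also have "cong_dvd f \<dots> (\<Sum>i\<in>?A. lead i (cmp i x) + lead i (cmp i y))"
    unfolding cmp_add by (intro cong_dvd_sum lead_add homog_cmp)
  also have "\<dots> = (\<Sum>i\<in>?A. lead i (cmp i x)) + (\<Sum>i\<in>?A. lead i (cmp i y))"
    by (rule sum.distrib)
  also have "cong_dvd f \<dots> (grE x + grE y)"
    by (intro cong_dvd_add cong_dvd_sym[OF grE_superset[OF A]]) auto
  finally show ?thesis .
qed

text \<open>Additivity reduces both arguments to homogeneous ones. There
  \<open>a * y + x * b\<close> represents \<open>E (x * y)\<close>, and its component of degree
  \<open>i + j + \<delta>\<close> is the product rule for the leading forms.\<close>

lemma grE_mult: "cong_dvd f (grE (x * y)) (grE x * y + x * grE y)"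
proof (induction x rule: homog_induct)
  case x: (homog i x)
  show ?case
  proof (induction y rule: homog_induct)
    case y: (homog j y)
    obtain a where a: "bounded (i + \<delta>) a" "cong_dvd g (E x) a"
      using obtain_image homog_bounded[OF x order_refl] by blast
    obtain b where b: "bounded (j + \<delta>) b" "cong_dvd g (E y) b"
      using obtain_image homog_bounded[OF y order_refl] by blast
    have e: "cong_dvd g (E (x * y)) (a * y + x * b)"
      using a(2) b(2) by (intro cong_dvd_trans[OF E_mult] cong_dvd_add cong_dvd_mult) auto
    have ay: "bounded (i + j + \<delta>) (a * y)" "cmp (i + j + \<delta>) (a * y) = cmp (i + \<delta>) a * y"
      using bounded_mult[OF a(1) homog_bounded[OF y order_refl]]
        cmp_mult_top[OF a(1) homog_bounded[OF y order_refl]] homog_cmp_eq[OF y]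
      by (simp_all add: ac_simps)
    have xb: "bounded (i + j + \<delta>) (x * b)" "cmp (i + j + \<delta>) (x * b) = x * cmp (j + \<delta>) b"
      using bounded_mult[OF homog_bounded[OF x order_refl] b(1)]
        cmp_mult_top[OF homog_bounded[OF x order_refl] b(1)] homog_cmp_eq[OF x]
      by (simp_all add: ac_simps)
    have "cong_dvd f (grE (x * y)) (cmp (i + j + \<delta>) (a * y + x * b))"
      using grE_homog[OF homog_mult[OF x y] bounded_add[OF ay(1) xb(1)] e] .
    also have "\<dots> = cmp (i + \<delta>) a * y + x * cmp (j + \<delta>) b"
      using ay(2) xb(2) by (simp add: cmp_add)
    also have "cong_dvd f \<dots> (grE x * y + x * grE y)"
      using grE_homog[OF x a] grE_homog[OF y b]
      by (intro cong_dvd_add cong_dvd_mult) (auto intro: cong_dvd_sym)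
    finally show ?case .
  next
    case (add y z)
    have "cong_dvd f (grE (x * (y + z))) (grE (x * y) + grE (x * z))"
      using grE_add by (simp add: distrib_left)
    also have "cong_dvd f \<dots> ((grE x * y + x * grE y) + (grE x * z + x * grE z))"
      by (rule cong_dvd_add[OF add])
    also have "\<dots> = grE x * (y + z) + x * (grE y + grE z)"
      by (simp add: algebra_simps)
    also have "cong_dvd f \<dots> (grE x * (y + z) + x * grE (y + z))"
      by (intro cong_dvd_add cong_dvd_mult) (auto intro: cong_dvd_sym grE_add)
    finally show ?case .
  qed
next
  case (add x z)
  have "cong_dvd f (grE ((x + z) * y)) (grE (x * y) + grE (z * y))"
    using grE_add by (simp add: distrib_right)
  also have "cong_dvd f \<dots> ((grE x * y + x * grE y) + (grE z * y + z * grE y))"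
    by (rule cong_dvd_add[OF add])
  also have "\<dots> = (grE x + grE z) * y + (x + z) * grE y"
    by (simp add: algebra_simps)
  also have "cong_dvd f \<dots> (grE (x + z) * y + (x + z) * grE y)"
    by (intro cong_dvd_add cong_dvd_mult) (auto intro: cong_dvd_sym grE_add)
  finally show ?case .
qed

text \<open>\<open>E f\<close> is congruent to \<open>E g + E c\<close>, and both terms vanish
  modulo \<open>g\<close>; hence 0 is an admissible representative of the image.\<close>

lemma grE_f: "cong_dvd f (grE f) 0"
proof -
  have "cong_dvd g (E g) 0"
    using cong_dvd_trans[OF E_cong E_zero] by (simp add: cong_dvd_0_iff)
  moreover have "cong_dvd g (E f) (E g + E c)" using E_add[of g c] g_def by simp
  ultimately have "cong_dvd g (E f) 0"
    using cong_dvd_trans cong_dvd_add[of g "E g" 0 "E c" 0] E_c by (metis add_0 cong_dvd_0_iff)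
  then show ?thesis using grE_homog[OF homog_f, of 0] by simp
qed

lemma grE_dvd: "f dvd x \<Longrightarrow> cong_dvd f (grE x) 0"
proof -
  assume "f dvd x"
  then obtain q where q: "x = f * q" by (auto elim: dvdE)
  have "cong_dvd f (grE f * q + f * grE q) (0 * q + 0 * grE q)"
    by (intro cong_dvd_add cong_dvd_mult grE_f) (auto simp: cong_dvd_0_iff)
  then show ?thesis using cong_dvd_trans[OF grE_mult[of f q]] q by simp
qed

lemma grE_cong: "cong_dvd f x y \<Longrightarrow> cong_dvd f (grE x) (grE y)"
  using cong_dvd_trans[OF grE_add[of "x - y" y] cong_dvd_add[OF grE_dvd cong_dvd_refl]]
  by (simp add: cong_dvd_def)

sublocale gr: derivation_modulo f grE
  by unfold_locales (auto intro: grE_cong grE_add grE_mult)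

lemma funpow_image:
  assumes "homog i r" shows "\<exists>e. bounded (i + int m * \<delta>) e \<and> cong_dvd g ((E ^^ m) r) e"
proof (induction m)
  case 0
  then show ?case using homog_bounded[OF assms] by auto
next
  case (Suc m)
  then obtain e where e: "bounded (i + int m * \<delta>) e" "cong_dvd g ((E ^^ m) r) e" by blast
  obtain e' where e': "bounded (i + int m * \<delta> + \<delta>) e'" "cong_dvd g (E e) e'"
    using obtain_image[OF e(1)] .
  have "cong_dvd g ((E ^^ Suc m) r) e'" using cong_dvd_trans[OF E_cong[OF e(2)] e'(2)] by simp
  with e'(1) show ?case by (auto simp: algebra_simps)
qed

lemma grE_funpow:
  assumes "homog i r" "bounded (i + int m * \<delta>) e" "cong_dvd g ((E ^^ m) r) e"
  shows "cong_dvd f ((grE ^^ m) r) (cmp (i + int m * \<delta>) e)"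
  using assms(2,3)
proof (induction m arbitrary: e)
  case 0
  then show ?case
    using leading_form_cong[OF homog_bounded[OF assms(1) order_refl]] homog_cmp_eq[OF assms(1)] by simp
next
  case (Suc m)
  let ?n = "i + int m * \<delta>"
  obtain u where u: "bounded ?n u" "cong_dvd g ((E ^^ m) r) u"
    using funpow_image[OF assms(1)] by blast
  let ?s = "cmp ?n u"
  \<comment> \<open>Replacing \<open>u\<close> by its component \<open>?s\<close> drops terms of
    degree below \<open>?n\<close>; their image has a representative below degree
    \<open>?n + \<delta>\<close> and does not affect the leading form there.\<close>
  have "bounded (?n - 1) (u - ?s)"
    by (intro bounded_pred bounded_diff u(1) homog_bounded[OF homog_cmp]) (simp_all add: cmp_diff cmp_cmp)
  then obtain t where t: "bounded (?n - 1 + \<delta>) t" "cong_dvd g (E (u - ?s)) t"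
    using obtain_image by blast
  have "cong_dvd g (E u) e"
    using Suc.prems(2) E_cong[OF u(2)] cong_dvd_trans cong_dvd_sym by (metis comp_apply funpow.simps(2))
  then have "cong_dvd g (E ?s) (e - t)"
    using cong_dvd_trans[OF E_diff[of u "u - ?s"] cong_dvd_diff[OF _ t(2)]] by simp
  moreover have "bounded (?n + \<delta>) (e - t)"
    using Suc.prems(1) bounded_mono[OF t(1), of "?n + \<delta>"] by (intro bounded_diff) (simp_all add: algebra_simps)
  ultimately have "cong_dvd f (grE ?s) (cmp (?n + \<delta>) (e - t))"
    using grE_homog[OF homog_cmp] by blast
  also have "cmp (?n + \<delta>) (e - t) = cmp (i + int (Suc m) * \<delta>) e"
    using t(1) by (simp add: cmp_diff bounded_def algebra_simps)
  finally have "cong_dvd f (grE ?s) (cmp (i + int (Suc m) * \<delta>) e)" .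
  then show ?case
    using cong_dvd_trans[OF grE_cong[OF Suc.IH[OF u]]] by simp
qed

lemma nilpotent_grE:
  assumes "nilpotent_mod g E" shows "nilpotent_mod f grE"
  unfolding nilpotent_mod_def
proof
  fix x show "\<exists>m>0. f dvd (grE ^^ m) x"
  proof (induction x rule: homog_induct)
    case (homog i r)
    obtain m where m: "m > 0" "g dvd (E ^^ m) r" using assms by (auto simp: nilpotent_mod_def)
    \<comment> \<open>Once \<open>E ^^ m\<close> kills \<open>r\<close> modulo \<open>g\<close>, the
      representative 0 is available, and its leading form is 0.\<close>
    then have "f dvd (grE ^^ m) r"
      using grE_funpow[OF homog, of m 0] by (simp add: cong_dvd_0_iff)
    with m(1) show ?case by blast
  next
    case (add x y)
    then obtain m n where mn: "m > 0" "f dvd (grE ^^ m) x" "f dvd (grE ^^ n) y" by blast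
    have "cong_dvd f ((grE ^^ (m + n)) x + (grE ^^ (m + n)) y) (0 + 0)"
      using gr.funpow_dvd_mono[OF mn(2), of "m + n"] gr.funpow_dvd_mono[OF mn(3), of "m + n"]
      by (intro cong_dvd_add) (simp_all add: cong_dvd_0_iff)
    then have "cong_dvd f ((grE ^^ (m + n)) (x + y)) 0"
      using cong_dvd_trans[OF gr.funpow_add] by simp
    with mn(1) show ?case by (auto simp: cong_dvd_0_iff intro!: exI[of _ "m + n"])
  qed
qed

text \<open>Take a component that violates the shift \<open>\<delta> - 1\<close>. Were the leading
  form of its image divisible by \<open>f\<close>, \<open>leading_form_cancel\<close> would yield a
  representative of lower degree, against the choice of the component.\<close>

lemma grE_nonzero: "\<exists>x. \<not> f dvd grE x"
proof -
  obtain x k where xk: "\<not> image_bounded (k + (\<delta> - 1)) (cmp k x)"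
    using shift_least by (auto simp: shift_at_most_def)
  let ?x = "cmp k x"
  obtain e where e: "bounded (k + \<delta>) e" "cong_dvd g (E ?x) e"
    using obtain_image[OF homog_bounded[OF homog_cmp order_refl]] .
  have "\<not> f dvd grE ?x"
  proof
    assume "f dvd grE ?x"
    then have "f dvd cmp (k + \<delta>) e"
      using grE_homog[OF homog_cmp e] cong_dvd_trans cong_dvd_sym cong_dvd_0_iff by metis
    then obtain y where y: "bounded (k + \<delta> - 1) y" "cong_dvd g e y"
      using leading_form_cancel[OF e(1)] by blast
    then show False using xk cong_dvd_trans[OF e(2) y(2)] by (auto simp: image_bounded_def algebra_simps)
  qed
  then show ?thesis by blast
qed

end

text \<open>\<open>kill\<close> and \<open>shift\<close> isolate what the polynomial ring has to
  supply: scalars are units, and finitely many variables generate the ring over them. A nonzero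
  \<open>E\<close> would then induce the nonzero \<open>grE\<close> on the rigid quotient by
  \<open>f\<close>.\<close>

theorem (in graded_deformation) rigid_deformation:
  assumes rigid: "rigid_mod f"
    and kill: "\<And>E. derivation_mod g E \<Longrightarrow> nilpotent_mod g E \<Longrightarrow> g dvd E c"
    and shift: "\<And>E. derivation_mod g E \<Longrightarrow> nilpotent_mod g E \<Longrightarrow>
      \<exists>N. \<forall>x. filtered_derivation.shift_at_most cmp g E N x"
  shows "rigid_mod g"
  unfolding rigid_mod_def
proof (intro allI impI, rule ccontr)
  fix E b
  assume E: "derivation_mod g E \<and> nilpotent_mod g E" and b: "\<not> g dvd E b"
  interpret derivation_modulo g E using E by (simp add: derivation_modulo_iff)
  interpret filtered_derivation cmp f c g d E by unfold_locales
  obtain N where "\<And>x. shift_at_most N x" using shift E by blast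
  then obtain \<delta> where \<delta>: "\<And>x. shift_at_most \<delta> x" "\<exists>x. \<not> shift_at_most (\<delta> - 1) x"
    using obtain_least_shift b by blast
  interpret least_shift cmp f c g d E \<delta>
    using \<delta> kill E by unfold_locales auto
  have "derivation_mod f grE" using gr.derivation_modulo_axioms by (simp add: derivation_modulo_iff)
  then show False using rigid nilpotent_grE E grE_nonzero by (auto simp: rigid_mod_def)
qed

subsection \<open>The quotient by a principal ideal\<close>

definition coset :: "'r::comm_ring_1 \<Rightarrow> 'r \<Rightarrow> 'r set" where
  "coset g a = {x. cong_dvd g x a}"

lemma coset_eq_iff: "coset g a = coset g b \<longleftrightarrow> cong_dvd g a b"
proof
  show "coset g a = coset g b \<Longrightarrow> cong_dvd g a b"
    unfolding coset_def by blast
  show "cong_dvd g a b \<Longrightarrow> coset g a = coset g b"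
    unfolding coset_def using cong_dvd_trans cong_dvd_sym by blast
qed

lemma ideal_principal: "ideal (PIdl\<^bsub>ring_of_type_algebra\<^esub> g) (ring_of_type_algebra :: 'r::comm_ring_1 ring)"
  by (rule cring.cgenideal_ideal[OF cring_from_type_algebra]) (simp add: ring_of_type_algebra_def)

lemma principal_eq: "PIdl\<^bsub>ring_of_type_algebra\<^esub> g = {x. g dvd x}"
  for g :: "'r::comm_ring_1"
  by (auto simp: cgenideal_def ring_of_type_algebra_def dvd_def mult.commute)

lemma a_r_coset_eq: "(PIdl\<^bsub>ring_of_type_algebra\<^esub> g) +>\<^bsub>ring_of_type_algebra\<^esub> a = coset g a"
  for g :: "'r::comm_ring_1"
proof -
  have "\<exists>h. g dvd h \<and> x = h + a" if "g dvd x - a" for x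
    using that by (intro exI[of _ "x - a"]) simp
  then show ?thesis
    unfolding principal_eq a_r_coset_def'
    by (auto simp: ring_of_type_algebra_def coset_def cong_dvd_def)
qed

lemma carrier_quot: "carrier (quot_principal g) = range (coset g)"
  for g :: "'r::comm_ring_1"
  unfolding quot_principal_def FactRing_def A_RCOSETS_def'
  by (auto simp: a_r_coset_eq) (auto simp: ring_of_type_algebra_def)

lemma zero_quot: "\<zero>\<^bsub>quot_principal g\<^esub> = coset g 0" for g :: "'r::comm_ring_1"
  by (simp add: quot_principal_def FactRing_def principal_eq coset_def cong_dvd_def)

lemma one_quot: "\<one>\<^bsub>quot_principal g\<^esub> = coset g 1" for g :: "'r::comm_ring_1"
  by (simp add: quot_principal_def FactRing_def a_r_coset_eq) (simp add: ring_of_type_algebra_def)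

lemma add_quot: "coset g a \<oplus>\<^bsub>quot_principal g\<^esub> coset g b = coset g (a + b)"
  for g :: "'r::comm_ring_1"
  using abelian_subgroup.a_rcos_sum[OF abelian_subgroupI3[OF
      ideal.axioms(1)[OF ideal_principal[of g]] ring.is_abelian_group[OF ring_from_type_algebra]], of a b]
  unfolding a_r_coset_eq quot_principal_def FactRing_def
  by (simp add: ring_of_type_algebra_def)

lemma mult_quot: "coset g a \<otimes>\<^bsub>quot_principal g\<^esub> coset g b = coset g (a * b)"
  for g :: "'r::comm_ring_1"
  using ideal.rcoset_mult_add[OF ideal_principal[of g], of a b]
  unfolding a_r_coset_eq quot_principal_def FactRing_def
  by (simp add: ring_of_type_algebra_def)

lemma domain_quot:
  fixes g :: "'r::comm_ring_1"
  assumes "prime_elem g" shows "domain (quot_principal g)"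
  unfolding quot_principal_def
proof (intro primeideal.quotient_is_domain primeidealI ideal_principal cring_from_type_algebra)
  show "carrier ring_of_type_algebra \<noteq> PIdl\<^bsub>ring_of_type_algebra\<^esub> g"
    using assms unfolding principal_eq by (auto simp: ring_of_type_algebra_def prime_elem_def)
  show "a \<in> PIdl\<^bsub>ring_of_type_algebra\<^esub> g \<or> b \<in> PIdl\<^bsub>ring_of_type_algebra\<^esub> g"
    if "a \<otimes>\<^bsub>ring_of_type_algebra\<^esub> b \<in> PIdl\<^bsub>ring_of_type_algebra\<^esub> g" for a b
    using that prime_elem_dvd_multD[OF assms] unfolding principal_eq
    by (simp add: ring_of_type_algebra_def)
qed

lemma Units_quot: "Units (quot_principal g) = {coset g a | a. \<exists>b. cong_dvd g (a * b) 1}"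
  for g :: "'r::comm_ring_1"
proof -
  have "Units (quot_principal g) = {A. \<exists>a. A = coset g a \<and> (\<exists>b. cong_dvd g (a * b) 1)}"
    by (auto simp: Units_def carrier_quot one_quot mult_quot coset_eq_iff mult.commute) blast
  then show ?thesis by blast
qed

lemma funpow_coset:
  assumes "\<And>a. D (coset g a) = coset g (E a)" shows "(D ^^ m) (coset g a) = coset g ((E ^^ m) a)"
  by (induction m) (auto simp: assms)

lemma derivation_coset_iff:
  assumes "\<And>a. D (coset g a) = coset g (E a)"
  shows "derivation (quot_principal g) D \<longleftrightarrow> derivation_mod g E"
proof -
  have "cong_dvd g a b \<Longrightarrow> cong_dvd g (E a) (E b)" for a b
    using assms by (metis coset_eq_iff)
  then show ?thesis
    by (auto simp: derivation_def derivation_mod_def carrier_quot assms add_quot mult_quot coset_eq_iff)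
qed

lemma locally_nilpotent_coset_iff:
  assumes "\<And>a. D (coset g a) = coset g (E a)"
  shows "locally_nilpotent (quot_principal g) D \<longleftrightarrow> nilpotent_mod g E"
  by (auto simp: locally_nilpotent_def nilpotent_mod_def carrier_quot funpow_coset[of D, OF assms]
      zero_quot coset_eq_iff cong_dvd_0_iff)

lemma rigid_quot_iff: "rigid (quot_principal g) \<longleftrightarrow> rigid_mod g"
  for g :: "'r::comm_ring_1"
proof -
  have vanish: "(\<forall>b\<in>carrier (quot_principal g). D b = \<zero>\<^bsub>quot_principal g\<^esub>) \<longleftrightarrow> (\<forall>b. g dvd E b)"
    if "\<And>a. D (coset g a) = coset g (E a)" for D E
    using that by (auto simp: carrier_quot zero_quot coset_eq_iff cong_dvd_0_iff)
  show ?thesis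
  proof
    assume rigid: "rigid (quot_principal g)"
    show "rigid_mod g" unfolding rigid_mod_def
    proof (intro allI impI)
      fix E b assume E: "derivation_mod g E \<and> nilpotent_mod g E"
      \<comment> \<open>The map on cosets uses an arbitrary representative; \<open>E\<close>
        respects congruence, so the choice is immaterial.\<close>
      define D where "D S = coset g (E (SOME a. S = coset g a))" for S
      have D: "D (coset g a) = coset g (E a)" for a
      proof -
        have "coset g a = coset g (SOME b. coset g a = coset g b)"
          by (rule someI[of _ a]) simp
        then have "cong_dvd g (E (SOME b. coset g a = coset g b)) (E a)"
          using E by (metis coset_eq_iff derivation_mod_def)
        then show ?thesis by (simp add: D_def coset_eq_iff)
      qed
      show "g dvd E b"
        using rigid E vanish[of D E, OF D] derivation_coset_iff[of D, OF D]
          locally_nilpotent_coset_iff[of D, OF D] unfolding rigid_def by blast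
    qed
  next
    assume rigid: "rigid_mod g"
    show "rigid (quot_principal g)" unfolding rigid_def
    proof (intro allI impI)
      fix D assume D: "derivation (quot_principal g) D \<and> locally_nilpotent (quot_principal g) D"
      then have "D (coset g a) \<in> range (coset g)" for a
        by (auto simp: derivation_def carrier_quot)
      then have "\<forall>a. \<exists>b. D (coset g a) = coset g b" by blast
      \<comment> \<open>Conversely, \<open>E\<close> picks a representative of each value of
        \<open>D\<close>; identities between cosets become congruences modulo
        \<open>g\<close>.\<close>
      then obtain E where E: "\<And>a. D (coset g a) = coset g (E a)" by metis
      show "\<forall>b\<in>carrier (quot_principal g). D b = \<zero>\<^bsub>quot_principal g\<^esub>"
        using rigid D vanish[of D E, OF E] derivation_coset_iff[of D, OF E]
          locally_nilpotent_coset_iff[of D, OF E] unfolding rigid_mod_def by blast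
    qed
  qed
qed

subsection \<open>Polynomial rings and their gradings\<close>

text \<open>The library orders exponent vectors, and derives the absence of zero divisors, only for
  linearly ordered variables; an enumeration of the finite set of variables transports the order.\<close>

definition enum_exp :: "('x::finite \<Rightarrow>\<^sub>0 nat) \<Rightarrow> (nat \<Rightarrow>\<^sub>0 nat)" where
  "enum_exp m = (\<Sum>x\<in>UNIV. Poly_Mapping.single (to_nat_on (UNIV :: 'x set) x) (Poly_Mapping.lookup m x))"

lemma enum_exp_add: "enum_exp (m + n) = enum_exp m + enum_exp n"
  by (simp add: enum_exp_def lookup_add single_add sum.distrib)

lemma lookup_enum_exp: "Poly_Mapping.lookup (enum_exp m) (to_nat_on (UNIV :: 'x::finite set) x) = Poly_Mapping.lookup m x"
proof -
  have "inj (to_nat_on (UNIV :: 'x set))" by (simp add: inj_on_to_nat_on countable_finite)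
  then show ?thesis
    by (simp add: enum_exp_def lookup_sum lookup_single when_def inj_eq)
qed

lemma inj_enum_exp: "inj enum_exp"
  by (rule injI, rule poly_mapping_eqI) (metis lookup_enum_exp)

lemma poly_mapping_nat_nonneg: "0 \<le> (m :: nat \<Rightarrow>\<^sub>0 nat)"
proof -
  have "\<not> m < 0" by (auto simp: less_poly_mapping.rep_eq less_fun_def)
  then show ?thesis by simp
qed

text \<open>With \<open>m\<close> and \<open>n\<close> the largest exponents in the transported
  order, \<open>m + n\<close> arises from this pair alone, so nothing cancels it. The maximality of
  \<open>m\<close> is kept for the determination of units.\<close>

lemma keys_mult_top:
  fixes p q :: "('x::finite, 'k::field) mpoly"
  assumes "p \<noteq> 0" "q \<noteq> 0"
  obtains m n where "m \<in> Poly_Mapping.keys p" "n \<in> Poly_Mapping.keys q" "m + n \<in> Poly_Mapping.keys (p * q)"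
    "\<And>i. i \<in> Poly_Mapping.keys p \<Longrightarrow> enum_exp i \<le> enum_exp m"
proof -
  have top: "\<exists>m\<in>Poly_Mapping.keys r. \<forall>i\<in>Poly_Mapping.keys r. enum_exp i \<le> enum_exp m" if "r \<noteq> 0" for r :: "('x, 'k) mpoly"
  proof -
    have "Poly_Mapping.keys r \<noteq> {}" using that by simp
    then have "Max (enum_exp ` Poly_Mapping.keys r) \<in> enum_exp ` Poly_Mapping.keys r" by (intro Max_in) auto
    then obtain m where "m \<in> Poly_Mapping.keys r" "Max (enum_exp ` Poly_Mapping.keys r) = enum_exp m" by auto
    then show ?thesis by (intro bexI[of _ m]) (auto intro: Max_ge simp flip: \<open>Max _ = _\<close>)
  qed
  obtain m where m: "m \<in> Poly_Mapping.keys p" "\<And>i. i \<in> Poly_Mapping.keys p \<Longrightarrow> enum_exp i \<le> enum_exp m"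
    using top[OF assms(1)] by blast
  obtain n where n: "n \<in> Poly_Mapping.keys q" "\<And>i. i \<in> Poly_Mapping.keys q \<Longrightarrow> enum_exp i \<le> enum_exp n"
    using top[OF assms(2)] by blast
  \<comment> \<open>The leading terms \<open>s\<close> and \<open>t\<close> are split off; of the
    three parts of \<open>p * q\<close> only \<open>s * t\<close> contributes to the exponent
    \<open>m + n\<close>.\<close>
  define s where "s = Poly_Mapping.single m (Poly_Mapping.lookup p m)"
  define t where "t = Poly_Mapping.single n (Poly_Mapping.lookup q n)"
  have ks: "Poly_Mapping.keys (p - s) \<subseteq> Poly_Mapping.keys p - {m}" and kt: "Poly_Mapping.keys (q - t) \<subseteq> Poly_Mapping.keys q - {n}"
    by (auto simp: in_keys_iff lookup_minus s_def t_def lookup_single when_def split: if_splits)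
  have "m + n \<notin> Poly_Mapping.keys (s * (q - t))"
  proof
    assume "m + n \<in> Poly_Mapping.keys (s * (q - t))"
    then obtain j where "m + n = m + j" "j \<in> Poly_Mapping.keys (q - t)"
      using keys_mult[of s "q - t"] unfolding s_def by (auto split: if_splits)
    then show False using kt by auto
  qed
  moreover have "m + n \<notin> Poly_Mapping.keys ((p - s) * q)"
  proof
    assume "m + n \<in> Poly_Mapping.keys ((p - s) * q)"
    then obtain i j where ij: "m + n = i + j" "i \<in> Poly_Mapping.keys (p - s)" "j \<in> Poly_Mapping.keys q"
      using keys_mult[of "p - s" q] by auto
    then have "enum_exp i < enum_exp m"
      using m(2)[of i] ks by (auto simp: order_less_le inj_eq[OF inj_enum_exp])
    then have "enum_exp i + enum_exp j < enum_exp m + enum_exp n"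
      using n(2)[OF ij(3)] by (rule add_less_le_mono)
    then show False using ij(1) by (metis enum_exp_add less_irrefl)
  qed
  moreover have "p * q = s * t + (s * (q - t) + (p - s) * q)"
    by (simp add: algebra_simps)
  ultimately have "Poly_Mapping.lookup (p * q) (m + n) = Poly_Mapping.lookup (s * t) (m + n)"
    by (simp add: lookup_add in_keys_iff)
  also have "\<dots> = Poly_Mapping.lookup p m * Poly_Mapping.lookup q n"
    by (simp add: s_def t_def mult_single)
  finally have "m + n \<in> Poly_Mapping.keys (p * q)" using m(1) n(1) by (simp add: in_keys_iff)
  then show ?thesis using that m n by blast
qed

lemma mpoly_no_zero_div: "p * q = 0 \<Longrightarrow> p = 0 \<or> q = 0"
  for p q :: "('x::finite, 'k::field) mpoly"
  using keys_mult_top[of p q] by (metis empty_iff keys_zero)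

lemma Const_simps:
  "Const (a + b) = Const a + Const b" "Const (a * b) = Const a * Const b"
  "Const 1 = 1" "Const 0 = 0" "Const (of_nat n) = of_nat n"
  by (simp_all add: Const_def single_add mult_single)

text \<open>The exponent \<open>m + n\<close> occurs in \<open>u * v = 1\<close>, so it is 0 and
  \<open>m = 0\<close>. The largest exponent of \<open>u\<close> is thus the least one possible,
  which leaves only a constant term.\<close>

lemma mpoly_units:
  fixes u v :: "('x::finite, 'k::field) mpoly"
  assumes "u * v = 1" obtains a where "a \<noteq> 0" "u = Const a"
proof -
  have "u \<noteq> 0" "v \<noteq> 0" using assms by auto
  then obtain m n where mn: "m + n \<in> Poly_Mapping.keys (u * v)" "\<And>i. i \<in> Poly_Mapping.keys u \<Longrightarrow> enum_exp i \<le> enum_exp m"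
    using keys_mult_top by metis
  have "m + n = 0" using mn(1) assms by simp
  then have "Poly_Mapping.lookup m x + Poly_Mapping.lookup n x = 0" for x by (metis lookup_add lookup_zero)
  then have "m = 0" by (intro poly_mapping_eqI) simp
  have "i = 0" if "i \<in> Poly_Mapping.keys u" for i
  proof -
    have "enum_exp i = enum_exp (0 :: 'x \<Rightarrow>\<^sub>0 nat)"
      using mn(2)[OF that] \<open>m = 0\<close> poly_mapping_nat_nonneg[of "enum_exp i"] by (simp add: enum_exp_def)
    then show ?thesis by (simp add: inj_eq[OF inj_enum_exp])
  qed
  then have "u = Const (Poly_Mapping.lookup u 0)"
    by (intro poly_mapping_eqI) (auto simp: Const_def lookup_single when_def in_keys_iff)
  then show ?thesis using that \<open>u \<noteq> 0\<close> by (metis Const_simps(4))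
qed

lemma Const_inverse: "a \<noteq> 0 \<Longrightarrow> Const a * Const (inverse a) = 1"
  for a :: "'k::field"
  by (simp flip: Const_simps(2) add: Const_simps(3))

text \<open>Meant for properties such as \<open>shift_at_most\<close>. Powers of variables,
  monomials, terms and sums of terms are reached in turn.\<close>

lemma mpoly_induct [case_names Const Var add mult]:
  fixes p :: "('x::finite, 'k::field) mpoly"
  assumes Const: "\<And>a. P (Const a)" and Var: "\<And>x. P (Var x)"
    and add: "\<And>p q. P p \<Longrightarrow> P q \<Longrightarrow> P (p + q)" and mult: "\<And>p q. P p \<Longrightarrow> P q \<Longrightarrow> P (p * q)"
  shows "P p"
proof -
  let ?s = "\<lambda>m. Poly_Mapping.single m 1 :: ('x, 'k) mpoly"
  have power: "P (?s (Poly_Mapping.single x n))" for x n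
  proof (induction n)
    case 0
    then show ?case using Const[of 1] by (simp add: Const_def)
  next
    case (Suc n)
    have "?s (Poly_Mapping.single x (Suc n)) = Var x * ?s (Poly_Mapping.single x n)"
      by (simp add: Var_def mult_single flip: single_add)
    then show ?case using mult[OF Var Suc] by simp
  qed
  have monom: "P (?s (\<Sum>x\<in>A. Poly_Mapping.single x (Poly_Mapping.lookup m x)))" for A m
  proof (induction A rule: infinite_finite_induct)
    case (insert x A)
    have "?s (Poly_Mapping.single x (Poly_Mapping.lookup m x) + (\<Sum>x\<in>A. Poly_Mapping.single x (Poly_Mapping.lookup m x))) =
        ?s (Poly_Mapping.single x (Poly_Mapping.lookup m x)) * ?s (\<Sum>x\<in>A. Poly_Mapping.single x (Poly_Mapping.lookup m x))"
      by (simp add: mult_single)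
    then show ?case using insert mult[OF power] by simp
  qed (use Const[of 1] in \<open>simp_all add: Const_def\<close>)
  have expand: "m = (\<Sum>x\<in>UNIV. Poly_Mapping.single x (Poly_Mapping.lookup m x))" for m :: "'x \<Rightarrow>\<^sub>0 nat"
    by (rule poly_mapping_eqI) (simp add: lookup_sum lookup_single when_def)
  have "P (Poly_Mapping.single m a)" for m a
  proof -
    have "P (Const a * ?s m)" using mult[OF Const monom] expand by metis
    then show ?thesis by (simp add: Const_def mult_single)
  qed
  then have "P (\<Sum>m\<in>A. Poly_Mapping.single m (Poly_Mapping.lookup p m))" for A
  proof (induction A rule: infinite_finite_induct)
    case (insert x A)
    then show ?case using add by simp
  qed (use Const[of 0] in \<open>simp_all add: Const_simps\<close>)
  moreover have "p = (\<Sum>m\<in>Poly_Mapping.keys p. Poly_Mapping.single m (Poly_Mapping.lookup p m))"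
    by (rule poly_mapping_eqI) (simp add: lookup_sum lookup_single when_def in_keys_iff)
  ultimately show ?thesis by metis
qed

text \<open>The description is justified by the unique existence in \<open>nat_grading\<close>;
  negative degrees get the default 0 that \<open>graded_domain\<close> demands.\<close>

definition grading_cmp :: "(nat \<Rightarrow> 'r::comm_ring_1 set) \<Rightarrow> int \<Rightarrow> 'r \<Rightarrow> 'r" where
  "grading_cmp G k x = (if k < 0 then 0 else
     (THE h. (\<forall>i. h i \<in> G i) \<and> finite {i. h i \<noteq> 0} \<and> x = (\<Sum>i | h i \<noteq> 0. h i)) (nat k))"

context
  fixes G :: "nat \<Rightarrow> 'r::comm_ring_1 set"
  assumes G: "nat_grading G"
begin

lemma grading_0: "0 \<in> G i"
  and grading_add: "x \<in> G i \<Longrightarrow> y \<in> G i \<Longrightarrow> x + y \<in> G i"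
proof -
  have "additive_subgroup (G i) ring_of_type_algebra" using G by (simp add: nat_grading_def)
  then show "0 \<in> G i" "x \<in> G i \<Longrightarrow> y \<in> G i \<Longrightarrow> x + y \<in> G i"
    using additive_subgroup.zero_closed[of "G i" ring_of_type_algebra]
      additive_subgroup.a_closed[of "G i" ring_of_type_algebra x y]
    by (simp_all add: ring_of_type_algebra_def)
qed

lemma grading_cmp:
  "grading_cmp G (int i) x \<in> G i"
  "finite {i. grading_cmp G (int i) x \<noteq> 0}"
  "(\<Sum>i | grading_cmp G (int i) x \<noteq> 0. grading_cmp G (int i) x) = x"
proof -
  let ?P = "\<lambda>h. (\<forall>i. h i \<in> G i) \<and> finite {i. h i \<noteq> 0} \<and> x = (\<Sum>i | h i \<noteq> 0. h i)"
  have "\<exists>!h. ?P h" using G unfolding nat_grading_def by (elim conjE allE[of _ x])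
  then have "?P (THE h. ?P h)" by (rule theI')
  then show "grading_cmp G (int i) x \<in> G i"
    "finite {i. grading_cmp G (int i) x \<noteq> 0}"
    "(\<Sum>i | grading_cmp G (int i) x \<noteq> 0. grading_cmp G (int i) x) = x"
    by (simp_all add: grading_cmp_def)
qed

lemma grading_cmp_unique:
  assumes "\<And>i. h i \<in> G i" "finite A" "\<And>i. i \<notin> A \<Longrightarrow> h i = 0" "x = (\<Sum>i\<in>A. h i)"
  shows "grading_cmp G (int i) x = h i"
proof -
  let ?P = "\<lambda>h. (\<forall>i. h i \<in> G i) \<and> finite {i. h i \<noteq> 0} \<and> x = (\<Sum>i | h i \<noteq> 0. h i)"
  have sub: "{i. h i \<noteq> 0} \<subseteq> A" using assms(3) by auto
  then have "?P h"
    using assms finite_subset[OF sub] by (auto intro!: sum.mono_neutral_right)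
  moreover have "\<exists>!h. ?P h" using G unfolding nat_grading_def by (elim conjE allE[of _ x])
  ultimately have "(THE h. ?P h) = h" by (rule the1_equality[rotated])
  then show ?thesis by (simp add: grading_cmp_def)
qed

lemma grading_cmp_in:
  assumes "x \<in> G j" shows "grading_cmp G (int i) x = (if i = j then x else 0)"
  using grading_cmp_unique[of "\<lambda>i. if i = j then x else 0" "{j}" x i] assms grading_0 by simp

lemma grading_cmp_neg: "k < 0 \<Longrightarrow> grading_cmp G k x = 0"
  by (simp add: grading_cmp_def)

lemma grading_cmp_zero: "grading_cmp G k 0 = 0"
  using grading_cmp_in[OF grading_0, of "nat k" 0] by (cases "k < 0") (simp_all add: grading_cmp_neg)

lemma support_eq: "{k. grading_cmp G k x \<noteq> 0} = int ` {i. grading_cmp G (int i) x \<noteq> 0}"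
proof -
  have "k \<in> int ` {i. grading_cmp G (int i) x \<noteq> 0}" if "grading_cmp G k x \<noteq> 0" for k
    using that grading_cmp_neg[of k x] by (intro image_eqI[of _ _ "nat k"]) (cases "k < 0"; simp)+
  then show ?thesis by blast
qed

lemma graded_domain_grading_cmp:
  assumes "\<And>x y :: 'r. x * y = 0 \<Longrightarrow> x = 0 \<or> y = 0"
  shows "graded_domain (grading_cmp G)"
proof
  fix x y :: 'r and i j k :: int
  show "grading_cmp G k (x + y) = grading_cmp G k x + grading_cmp G k y"
  proof (cases "k < 0")
    case False
    \<comment> \<open>Over the union of the supports the two families can be added termwise;
      uniqueness identifies the result with the components of \<open>x + y\<close>.\<close>
    let ?A = "{i. grading_cmp G (int i) x \<noteq> 0} \<union> {i. grading_cmp G (int i) y \<noteq> 0}"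
    have A: "finite ?A" using grading_cmp(2) by blast
    have "z = (\<Sum>i\<in>?A. grading_cmp G (int i) z)" if "z = x \<or> z = y" for z
      using grading_cmp(3)[of z] A that
      by (subst sum.mono_neutral_right[of ?A "{i. grading_cmp G (int i) z \<noteq> 0}"]) auto
    then have "x + y = (\<Sum>i\<in>?A. grading_cmp G (int i) x) + (\<Sum>i\<in>?A. grading_cmp G (int i) y)"
      by metis
    then have "x + y = (\<Sum>i\<in>?A. grading_cmp G (int i) x + grading_cmp G (int i) y)"
      by (simp only: sum.distrib)
    from grading_cmp_unique[OF _ A _ this, of "nat k"] show ?thesis
      using False by (simp add: grading_add grading_cmp(1))
  qed (simp add: grading_cmp_neg)
  show "finite {k. grading_cmp G k x \<noteq> 0}"
    unfolding support_eq using grading_cmp(2) by blast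
  show "(\<Sum>k | grading_cmp G k x \<noteq> 0. grading_cmp G k x) = x"
    unfolding support_eq by (subst sum.reindex) (simp_all add: grading_cmp(3))
  show "grading_cmp G j (grading_cmp G k x) = (if j = k then grading_cmp G k x else 0)"
  proof (cases "k < 0 \<or> j < 0")
    case True
    then show ?thesis by (auto simp: grading_cmp_neg grading_cmp_zero)
  next
    case False
    then show ?thesis using grading_cmp_in[OF grading_cmp(1), of "nat j" "nat k" x] by auto
  qed
  show "grading_cmp G (i + j) (grading_cmp G i x * grading_cmp G j y) = grading_cmp G i x * grading_cmp G j y"
  proof (cases "i < 0 \<or> j < 0")
    case True
    then show ?thesis by (auto simp: grading_cmp_neg grading_cmp_zero)
  next
    case False
    then have "grading_cmp G i x \<in> G (nat i)" "grading_cmp G j y \<in> G (nat j)"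
      using grading_cmp(1)[of "nat i"] grading_cmp(1)[of "nat j"] by auto
    then have "grading_cmp G i x * grading_cmp G j y \<in> G (nat i + nat j)"
      using G by (auto simp: nat_grading_def)
    from grading_cmp_in[OF this, of "nat i + nat j"] show ?thesis using False by simp
  qed
qed (use assms grading_cmp_neg in auto)

end

theorem proposition10p5:
  fixes G :: "nat \<Rightarrow> ('x::finite, 'k::field_char_0) mpoly set"
    and f :: "('x, 'k) mpoly"
    and i1 :: 'x
  assumes "CARD('x) \<ge> 2"
    and "nat_grading G"
    and "\<forall>i. homogeneous G (Var i)"
    and "\<exists>d>0. Var i1 \<in> G d"
    and "homogeneous G f"
    and "prime_elem f"
    and "f \<notin> adjoin (G 0) (Var i1)"
  shows "(\<forall>c. domain (quot_principal (f - Const c)) \<and>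
              trivial_units (quot_scalar (f - Const c)) (quot_principal (f - Const c))) \<and>
         (rigid (quot_principal f) \<longrightarrow> (\<forall>c. rigid (quot_principal (f - Const c))))"
proof -
  interpret graded_domain "grading_cmp G"
    using graded_domain_grading_cmp[OF assms(2)] mpoly_no_zero_div by blast
  have G_homog: "homog (int i) x" if "x \<in> G i" for i x
    using grading_cmp_in[OF assms(2) that] by (simp add: homog_def)
  \<comment> \<open>Nonzero constants are units, hence of degree 0.\<close>
  have Const_homog: "homog 0 (Const a)" for a :: 'k
    using unit_homog_0[OF Const_inverse] by (cases "a = 0") (auto simp: Const_simps)
  have "\<exists>i. homog i (Var x)" for x
    using assms(3) G_homog unfolding homogeneous_def by blast
  then obtain w where w: "\<And>x. homog (w x) (Var x)" by metis
  obtain d where d: "f \<in> G d" using assms(5) by (auto simp: homogeneous_def)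
  \<comment> \<open>An \<open>f\<close> of degree 0 would lie in
    \<open>adjoin (G 0) (Var i1)\<close> as the value of the constant polynomial
    \<open>[:f:]\<close>.\<close>
  have "d \<noteq> 0"
  proof
    assume "d = 0"
    then have "\<forall>i. Polynomial.coeff [:f:] i \<in> G 0"
      using d grading_0[OF assms(2)] by (auto simp: coeff_pCons split: nat.split)
    then have "f \<in> adjoin (G 0) (Var i1)"
      unfolding adjoin_def by (auto intro!: exI[of _ "[:f:]"])
    with assms(7) show False by blast
  qed
  have deform: "graded_deformation (grading_cmp G) f (Const c) (f - Const c) (int d)" for c
    using \<open>d \<noteq> 0\<close> G_homog[OF d] assms(6) Const_homog by unfold_locales auto
  have units: "trivial_units (quot_scalar (f - Const c)) (quot_principal (f - Const c))" for c
  proof -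
    interpret graded_deformation "grading_cmp G" f "Const c" "f - Const c" "int d" by (rule deform)
    let ?g = "f - Const c"
    \<comment> \<open>A unit modulo \<open>?g\<close> is represented by a unit of the ring itself,
      and such a unit is a nonzero constant.\<close>
    have "coset ?g a \<in> (\<lambda>e. coset ?g (Const e)) ` (UNIV - {0})" if ab: "cong_dvd ?g (a * b) 1" for a b
    proof -
      obtain u v where uv: "cong_dvd ?g a u" "u * v = 1" using unit_modulo[OF ab] .
      obtain e where "e \<noteq> 0" "u = Const e" using mpoly_units[OF uv(2)] .
      then show ?thesis using uv(1) by (auto simp: coset_eq_iff)
    qed
    moreover have "\<exists>b. cong_dvd ?g (Const e * b) 1" if "e \<noteq> 0" for e
      using Const_inverse[OF that] by (metis cong_dvd_refl)
    ultimately show ?thesis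
      unfolding trivial_units_def Units_quot quot_scalar_def a_r_coset_eq by auto
  qed
  have rigid: "rigid_mod (f - Const c)" if "rigid_mod f" for c
  proof -
    interpret graded_deformation "grading_cmp G" f "Const c" "f - Const c" "int d" by (rule deform)
    let ?g = "f - Const c"
    \<comment> \<open>Characteristic 0 enters here: a positive integer is nonzero in the field,
      hence invertible.\<close>
    have nat_units: "of_nat n dvd (1 :: ('x, 'k) mpoly)" if "n > 0" for n
      using Const_inverse[of "of_nat n :: 'k"] that by (metis Const_simps(5) dvdI of_nat_eq_0_iff not_gr0)
    have kill: "?g dvd E (Const a)" if E: "derivation_mod ?g E" "nilpotent_mod ?g E" for E a
    proof -
      interpret derivation_modulo ?g E using E by (simp add: derivation_modulo_iff)
      show ?thesis
      proof (cases "a = 0")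
        case True
        then show ?thesis using E_zero by (simp add: Const_simps cong_dvd_0_iff)
      next
        case False
        then show ?thesis
          using nilpotent_kills_units[OF E(2) prime_g nat_units Const_inverse] by blast
      qed
    qed
    have shift: "\<exists>N. \<forall>x. filtered_derivation.shift_at_most (grading_cmp G) ?g E N x"
      if E: "derivation_mod ?g E" "nilpotent_mod ?g E" for E
    proof -
      interpret derivation_modulo ?g E using E by (simp add: derivation_modulo_iff)
      interpret filtered_derivation "grading_cmp G" f "Const c" ?g "int d" E by unfold_locales
      have "\<exists>N. shift_at_most N (Var x)" for x using ex_shift_homog[OF w] .
      then obtain M where M: "\<And>x. shift_at_most (M x) (Var x)" by metis
      \<comment> \<open>The maximum exists because there are finitely many variables. Constants
        satisfy every shift, since \<open>kill\<close> makes 0 a representative of their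
        image.\<close>
      define N where "N = Max (range M)"
      have "shift_at_most N p" for p
      proof (induction p rule: mpoly_induct)
        case (Const a)
        have "cong_dvd ?g (E (Const a)) 0" using kill[OF E] by (simp add: cong_dvd_0_iff)
        then show ?case
          unfolding shift_at_most_homog_iff[OF Const_homog] image_bounded_def using bounded_0 by blast
      next
        case (Var x)
        have "M x \<le> N" unfolding N_def by (intro Max_ge) auto
        then show ?case using shift_at_most_mono[OF M] by blast
      qed (auto intro: shift_at_most_add shift_at_most_mult)
      then show ?thesis by blast
    qed
    show ?thesis
      by (rule rigid_deformation[OF that]) (erule (1) kill, erule (1) shift)
  qed
  show ?thesis
    using domain_quot graded_deformation.prime_g[OF deform] units rigid by (auto simp: rigid_quot_iff)
qed

end
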